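(* Let $A$ be a $K$-algebra containing $\Lambda$. Then there exists a unique function $F:\mathrm{SCH}\to A$, $P\mapsto F_P$, satisfying the following four conditions: (i) For all integers $k\ge 0$, $F_{\mathtt{n}\mathtt{d}^k\mathtt{e}}=\mathrm{e}_{k+1}$. (ii) $F$ is multiplicative: $F_{PQ}=F_PF_Q$ for all $P,Q\in\mathrm{SCH}$. (iii) For all words $U,V\in\{\mathtt{n},\mathtt{d},\mathtt{e}\}^*$ such that $U\mathtt{d}V\in\mathrm{SCH}$, we have $F_{U\mathtt{n}\mathtt{e}V}-F_{U\mathtt{e}\mathtt{n}V}=(q-1)F_{U\mathtt{d}V}$. (iv) Let $P\in\mathrm{SCH}$ and let $(x,z)\in\mathbb{Z}^2$ be a point on $P$ with $x+1<z$ such that the bounce path of $P$ at $(x,z)$ has exactly one bounce point, and such that the bounce decomposition of $P$ at $(x,z)$ is $P=Us\cdot tV\mathtt{d}\cdot\mathtt{e}W$ for some $V\in\{\mathtt{n},\mathtt{d}\}^*$ and some $st\in\{\mathtt{n}\mathtt{n},\mathtt{d}\mathtt{n}\}$. Then $F_P=qF_{U\mathtt{n}\mathtt{n}V\mathtt{e}\mathtt{d}W}$ if $st=\mathtt{n}\mathtt{n}$, and $F_P=F_{U\mathtt{n}\mathtt{d}V\mathtt{e}\mathtt{d}W}$ if $st=\mathtt{d}\mathtt{n}$.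
   Context: Let $K=\mathbb{Q}(q)$ and let $\Lambda$ be the algebra of symmetric functions over $K$ in variables $\mathbf{x}=(x_1,x_2,\dots)$; $\mathrm{e}_k$ denotes the elementary symmetric function and $\mathrm{e}_\lambda=\mathrm{e}_{\lambda_1}\mathrm{e}_{\lambda_2}\cdots$. Let $\mathtt{n}=(0,1)$, $\mathtt{e}=(1,0)$, $\mathtt{d}=(1,1)$ (north, east, diagonal steps). A Schröder path of size $n$ is a lattice path from $(0,0)$ to $(n,n)$ with steps in $\{\mathtt{n},\mathtt{e},\mathtt{d}\}$ such that every east step and every diagonal step is preceded by strictly more north steps than east steps (so it never goes below the line $y=x$ and has no diagonal step on that line). Paths are identified with words in $\{\mathtt{n},\mathtt{d},\mathtt{e}\}^*$, $PQ$ denotes concatenation, and $\mathrm{SCH}$ denotes the set of all Schröder paths of all sizes (including the empty path). Bounce path: given $P\in\mathrm{SCH}$ of size $n$ and a lattice point $(u_1,u_0)$ on $P$, start at $(u_1,u_0)$, move south to $(u_1,u_1)$ on the main diagonal, then move west until first reaching a point $(u_2,u_1)$ of $P$. If this point lies between two (consecutive) diagonal steps of $P$, continue south to $(u_2,u_2)$, then west to a point $(u_3,u_2)$ of $P$, and so on; the bounce path ends at the first point $(u_{k+1},u_k)$ so reached that is incident to a north step or an east step of $P$. The points $(u_1,u_1),\dots,(u_k,u_k)$ are the bounce points. The bounce decomposition of $P$ at $(u_1,u_0)$ is the unique factorisation $P=Us_1\cdot s_2Vs_3\cdot s_4W$ with single steps $s_1,s_2,s_3,s_4$ and words $U,V,W$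 such that $Us_1$ is the portion of $P$ from $(0,0)$ to the endpoint $(u_{k+1},u_k)$ of the bounce path and $s_4W$ is the portion of $P$ from $(u_1,u_0)$ to $(n,n)$. The dots only mark these two points and are not letters of the word.
   Formalization: In (iv) the word V may be any word in {n,d,e}*, since with V in {n,d}* uniqueness fails (nnddee is left undetermined); and multiplicativity in (ii) includes F of the empty path = 1, which does not follow when A has zero divisors. *)

theory Defs
  imports
    "HOL-Library.Poly_Mapping"
    "HOL-Library.FuncSet"
    "HOL-Computational_Algebra.Fraction_Field"
    "HOL-Computational_Algebra.Polynomial"
begin

section \<open>The algebra of symmetric functions\<close>

text \<open>
  A monomial in the variables \<open>x\<^sub>0, x\<^sub>1, \<dots>\<close> is its finitely supported exponent vector, so that the
  product of monomials is \<open>+\<close>.  A symmetric function is a formal power series (a function from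
  monomials to coefficients) of bounded degree that is invariant under all permutations of the
  variables.
\<close>

type_synonym monomial = "nat \<Rightarrow>\<^sub>0 nat"

definition mdeg :: "monomial \<Rightarrow> nat" where
  "mdeg m = (\<Sum>i\<in>Poly_Mapping.keys m. Poly_Mapping.lookup m i)"

definition bounded_degree :: "(monomial \<Rightarrow> 'a::zero) \<Rightarrow> bool" where
  "bounded_degree f \<longleftrightarrow> (\<exists>d. \<forall>m. f m \<noteq> 0 \<longrightarrow> mdeg m \<le> d)"

text \<open>For bijective \<open>\<sigma>\<close>, \<open>Poly_Mapping.map_key \<sigma> m\<close> has the exponent of \<open>x\<^bsub>\<sigma> i\<^esub>\<close> in \<open>m\<close> as its exponent of \<open>x\<^sub>i\<close>.\<close>

definition permutation_invariant :: "(monomial \<Rightarrow> 'a) \<Rightarrow> bool" where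
  "permutation_invariant f \<longleftrightarrow>
     (\<forall>\<sigma> m. bij \<sigma> \<longrightarrow> f (Poly_Mapping.map_key \<sigma> m) = f m)"

typedef (overloaded) 'a symfun =
  "{f :: monomial \<Rightarrow> 'a::zero. bounded_degree f \<and> permutation_invariant f}"
  morphisms coefficient Abs_symfun
  by (rule exI[of _ "\<lambda>_. 0"]) (simp add: bounded_degree_def permutation_invariant_def)

setup_lifting type_definition_symfun

lemma mdeg_superset:
  assumes "finite S" "Poly_Mapping.keys m \<subseteq> S"
  shows "mdeg m = (\<Sum>i\<in>S. Poly_Mapping.lookup m i)"
  unfolding mdeg_def using assms
  by (intro sum.mono_neutral_left) (auto simp: in_keys_iff)

lemma mdeg_add: "mdeg (a + b) = mdeg a + mdeg b"
proof -
  let ?S = "Poly_Mapping.keys a \<union> Poly_Mapping.keys b"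
  have "mdeg (a + b) = (\<Sum>i\<in>?S. Poly_Mapping.lookup (a + b) i)"
    by (rule mdeg_superset) (auto simp: in_keys_iff lookup_add)
  also have "\<dots> = (\<Sum>i\<in>?S. Poly_Mapping.lookup a i) + (\<Sum>i\<in>?S. Poly_Mapping.lookup b i)"
    by (simp add: lookup_add sum.distrib)
  also have "\<dots> = mdeg a + mdeg b"
    by (simp add: mdeg_superset[of ?S])
  finally show ?thesis .
qed

lemma mdeg_zero [simp]: "mdeg 0 = 0"
  by (simp add: mdeg_def)

definition splits :: "monomial \<Rightarrow> (monomial \<times> monomial) set" where
  "splits m = {(a, b). a + b = m}"

lemma finite_splits [simp]: "finite (splits m)"
proof -
  let ?M = "Max (Poly_Mapping.lookup m ` Poly_Mapping.keys m)"
  let ?F = "{f. \<forall>x. (x \<in> Poly_Mapping.keys m \<longrightarrow> f x \<in> {..?M}) \<and> (x \<notin> Poly_Mapping.keys m \<longrightarrow> f x = (0::nat))}"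
  have fin: "finite ?F"
    by (rule finite_set_of_finite_funs) auto
  have sub: "Poly_Mapping.lookup ` (fst ` splits m) \<subseteq> ?F"
  proof
    fix f assume "f \<in> Poly_Mapping.lookup ` (fst ` splits m)"
    then obtain a b where f: "f = Poly_Mapping.lookup a" and ab: "a + b = m"
      by (auto simp: splits_def)
    have le: "f x \<le> Poly_Mapping.lookup m x" for x
      unfolding f ab[symmetric] by (simp add: lookup_add)
    have "f x \<le> ?M" if "x \<in> Poly_Mapping.keys m" for x
    proof -
      have "Poly_Mapping.lookup m x \<le> ?M"
        by (rule Max_ge) (use that in auto)
      then show ?thesis using le[of x] by simp
    qed
    moreover have "f x = 0" if "x \<notin> Poly_Mapping.keys m" for x
      using le[of x] that by (simp add: in_keys_iff)
    ultimately show "f \<in> ?F" by simp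
  qed
  have "finite (Poly_Mapping.lookup ` (fst ` splits m))"
    using finite_subset[OF sub fin] .
  then have "finite (fst ` splits m)"
    by (rule finite_imageD) (auto simp: inj_on_def poly_mapping_eqI)
  moreover have "inj_on fst (splits m)"
    by (auto simp: inj_on_def splits_def)
  ultimately show ?thesis
    using finite_imageD by blast
qed

lemma map_key_bij_inverse:
  fixes m :: monomial
  assumes "bij \<sigma>"
  shows "Poly_Mapping.map_key \<sigma> (Poly_Mapping.map_key (inv \<sigma>) m) = m"
    and "Poly_Mapping.map_key (inv \<sigma>) (Poly_Mapping.map_key \<sigma> m) = m"
proof -
  have i: "inj \<sigma>" "inj (inv \<sigma>)" "surj \<sigma>"
    using assms bij_imp_bij_inv bij_is_inj bij_is_surj by blast+
  show "Poly_Mapping.map_key \<sigma> (Poly_Mapping.map_key (inv \<sigma>) m) = m"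
    by (rule poly_mapping_eqI) (simp add: map_key.rep_eq i inv_f_f)
  show "Poly_Mapping.map_key (inv \<sigma>) (Poly_Mapping.map_key \<sigma> m) = m"
    by (rule poly_mapping_eqI) (simp add: map_key.rep_eq i surj_f_inv_f)
qed

instantiation symfun :: (comm_ring_1) comm_ring_1
begin

lift_definition zero_symfun :: "'a symfun" is "\<lambda>_. 0"
  by (simp add: bounded_degree_def permutation_invariant_def)

lift_definition one_symfun :: "'a symfun" is "\<lambda>m. if m = 0 then 1 else 0"
proof
  show "bounded_degree (\<lambda>m. if m = 0 then 1 else 0 :: 'a)"
    by (auto simp: bounded_degree_def intro!: exI[of _ 0])
  show "permutation_invariant (\<lambda>m. if m = 0 then 1 else 0 :: 'a)"
    unfolding permutation_invariant_def
  proof (intro allI impI)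
    fix \<sigma> :: "nat \<Rightarrow> nat" and m :: monomial assume b: "bij \<sigma>"
    have "Poly_Mapping.map_key \<sigma> m = 0 \<longleftrightarrow> m = 0"
      using map_key_bij_inverse(2)[OF b, of m] by (metis b bij_imp_bij_inv bij_is_inj map_key_zero)
    then show "(if Poly_Mapping.map_key \<sigma> m = 0 then 1 else 0 :: 'a) = (if m = 0 then 1 else 0)"
      by simp
  qed
qed

lift_definition plus_symfun :: "'a symfun \<Rightarrow> 'a symfun \<Rightarrow> 'a symfun" is "\<lambda>f g m. f m + g m"
proof
  fix f g :: "monomial \<Rightarrow> 'a"
  assume f: "bounded_degree f \<and> permutation_invariant f"
    and g: "bounded_degree g \<and> permutation_invariant g"
  from f obtain d where d: "\<And>m. f m \<noteq> 0 \<Longrightarrow> mdeg m \<le> d"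
    by (auto simp: bounded_degree_def)
  from g obtain d' where d': "\<And>m. g m \<noteq> 0 \<Longrightarrow> mdeg m \<le> d'"
    by (auto simp: bounded_degree_def)
  have "mdeg m \<le> max d d'" if "f m + g m \<noteq> 0" for m
    using that d[of m] d'[of m] by (cases "f m = 0") auto
  then show "bounded_degree (\<lambda>m. f m + g m)"
    unfolding bounded_degree_def by blast
  show "permutation_invariant (\<lambda>m. f m + g m)"
    using f g by (simp add: permutation_invariant_def)
qed

lift_definition uminus_symfun :: "'a symfun \<Rightarrow> 'a symfun" is "\<lambda>f m. - f m"
  by (simp add: bounded_degree_def permutation_invariant_def)

definition minus_symfun :: "'a symfun \<Rightarrow> 'a symfun \<Rightarrow> 'a symfun" where
  "minus_symfun f g = f + (- g)"

lift_definition times_symfun :: "'a symfun \<Rightarrow> 'a symfun \<Rightarrow> 'a symfun"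
  is "\<lambda>f g m. \<Sum>(a, b) \<in> splits m. f a * g b"
proof
  fix f g :: "monomial \<Rightarrow> 'a"
  assume f: "bounded_degree f \<and> permutation_invariant f"
    and g: "bounded_degree g \<and> permutation_invariant g"
  from f obtain d where d: "\<And>m. f m \<noteq> 0 \<Longrightarrow> mdeg m \<le> d"
    by (auto simp: bounded_degree_def)
  from g obtain d' where d': "\<And>m. g m \<noteq> 0 \<Longrightarrow> mdeg m \<le> d'"
    by (auto simp: bounded_degree_def)
  have "mdeg m \<le> d + d'" if nz: "(\<Sum>(a, b) \<in> splits m. f a * g b) \<noteq> 0" for m
  proof -
    obtain p where p: "p \<in> splits m" "(case p of (a, b) \<Rightarrow> f a * g b) \<noteq> 0"
      using nz by (rule sum.not_neutral_contains_not_neutral)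
    then obtain a b where "a + b = m" "f a * g b \<noteq> 0"
      by (auto simp: splits_def)
    then show ?thesis
      using d[of a] d'[of b] by (force simp: mdeg_add)
  qed
  then show "bounded_degree (\<lambda>m. \<Sum>(a, b) \<in> splits m. f a * g b)"
    unfolding bounded_degree_def by blast
  show "permutation_invariant (\<lambda>m. \<Sum>(a, b) \<in> splits m. f a * g b)"
    unfolding permutation_invariant_def
  proof (intro allI impI)
    fix \<sigma> :: "nat \<Rightarrow> nat" and m :: monomial assume b: "bij \<sigma>"
    have inj: "inj \<sigma>" "inj (inv \<sigma>)"
      using b bij_imp_bij_inv bij_is_inj by blast+
    let ?k = "Poly_Mapping.map_key \<sigma>" and ?l = "Poly_Mapping.map_key (inv \<sigma>)"
    show "(\<Sum>(a, b) \<in> splits (?k m). f a * g b) = (\<Sum>(a, b) \<in> splits m. f a * g b)"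
    proof (rule sum.reindex_bij_witness[where i = "map_prod ?k ?k" and j = "map_prod ?l ?l"])
      fix p assume "p \<in> splits (?k m)"
      then obtain a c where ac: "p = (a, c)" "a + c = ?k m"
        by (auto simp: splits_def)
      show "map_prod ?k ?k (map_prod ?l ?l p) = p"
        by (simp add: ac map_key_bij_inverse[OF b])
      have "?l a + ?l c = m"
        by (simp add: ac map_key_bij_inverse[OF b] flip: map_key_plus[OF inj(2)])
      then show "map_prod ?l ?l p \<in> splits m"
        by (simp add: ac splits_def)
      have "f (?l a) = f a" "g (?l c) = g c"
        using f g bij_imp_bij_inv[OF b] by (auto simp: permutation_invariant_def)
      then show "(case map_prod ?l ?l p of (a, b) \<Rightarrow> f a * g b) = (case p of (a, b) \<Rightarrow> f a * g b)"
        by (simp add: ac)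
    next
      fix p assume "p \<in> splits m"
      then obtain a c where ac: "p = (a, c)" "a + c = m"
        by (auto simp: splits_def)
      show "map_prod ?l ?l (map_prod ?k ?k p) = p"
        by (simp add: ac map_key_bij_inverse[OF b])
      show "map_prod ?k ?k p \<in> splits (?k m)"
        by (simp add: ac(1) splits_def flip: map_key_plus[OF inj(1)] ac(2))
    qed
  qed
qed

instance
proof
  fix f g h :: "'a symfun"
  show "f + g + h = f + (g + h)" by transfer (simp add: add.assoc)
  show "f + g = g + f" by transfer (simp add: add.commute)
  show "0 + f = f" by transfer simp
  show "- f + f = 0" by transfer simp
  show "f - g = f + - g" by (rule minus_symfun_def)
  show "(0::'a symfun) \<noteq> 1" by transfer (auto dest: fun_cong[of _ _ 0])
  show "(f + g) * h = f * h + g * h"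
    by transfer (simp add: case_prod_unfold distrib_right sum.distrib)
  show "f * g = g * f"
  proof transfer
    fix f g :: "monomial \<Rightarrow> 'a"
    show "(\<lambda>m. \<Sum>(a, b) \<in> splits m. f a * g b) = (\<lambda>m. \<Sum>(a, b) \<in> splits m. g a * f b)"
      by (rule ext, rule sum.reindex_bij_witness[where i = prod.swap and j = prod.swap])
        (auto simp: splits_def add.commute mult.commute)
  qed
  show "1 * f = f"
  proof transfer
    fix f :: "monomial \<Rightarrow> 'a"
    have "(\<Sum>(a, b) \<in> splits m. (if a = 0 then 1 else 0) * f b) = f m" for m
    proof -
      have "(\<Sum>(a, b) \<in> splits m. (if a = 0 then 1 else 0) * f b)
          = (\<Sum>(a, b) \<in> {(0 :: monomial, m)}. (if a = 0 then 1 else 0) * f b)"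
        by (rule sum.mono_neutral_right, rule finite_splits) (auto simp: splits_def split: if_splits)
      then show ?thesis by simp
    qed
    then show "(\<lambda>m. \<Sum>(a, b) \<in> splits m. (if a = 0 then 1 else 0) * f b) = f"
      by blast
  qed
  show "f * g * h = f * (g * h)"
  proof transfer
    fix f g h :: "monomial \<Rightarrow> 'a"
    have "(\<Sum>(a, b) \<in> splits m. (\<Sum>(a, b) \<in> splits a. f a * g b) * h b)
        = (\<Sum>(a, b) \<in> splits m. f a * (\<Sum>(a, b) \<in> splits b. g a * h b))" for m
    proof -
      have "(\<Sum>(a, b) \<in> splits m. (\<Sum>(a, b) \<in> splits a. f a * g b) * h b)
          = (\<Sum>p \<in> splits m. \<Sum>r \<in> splits (fst p). f (fst r) * g (snd r) * h (snd p))"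
        by (simp add: case_prod_unfold sum_distrib_right)
      also have "\<dots> = (\<Sum>(p, r) \<in> (SIGMA p:splits m. splits (fst p)).
                          f (fst r) * g (snd r) * h (snd p))"
        by (rule sum.Sigma) auto
      also have "\<dots> = (\<Sum>(p, r) \<in> (SIGMA p:splits m. splits (snd p)).
                          f (fst p) * (g (fst r) * h (snd r)))"
        by (rule sum.reindex_bij_witness
              [where i = "\<lambda>(p, r). ((fst p + fst r, snd r), (fst p, fst r))"
                 and j = "\<lambda>(p, r). ((fst r, snd r + snd p), (snd r, snd p))"])
          (auto simp: splits_def add.assoc mult.assoc)
      also have "\<dots> = (\<Sum>p \<in> splits m. \<Sum>r \<in> splits (snd p). f (fst p) * (g (fst r) * h (snd r)))"
        by (rule sum.Sigma[symmetric]) auto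
      also have "\<dots> = (\<Sum>(a, b) \<in> splits m. f a * (\<Sum>(a, b) \<in> splits b. g a * h b))"
        by (simp add: case_prod_unfold sum_distrib_left)
      finally show ?thesis .
    qed
    then show "(\<lambda>m. \<Sum>(a, b) \<in> splits m. (\<Sum>(a, b) \<in> splits a. f a * g b) * h b)
        = (\<lambda>m. \<Sum>(a, b) \<in> splits m. f a * (\<Sum>(a, b) \<in> splits b. g a * h b))"
      by blast
  qed
qed

end

lift_definition symfun_scale :: "'a::comm_ring_1 \<Rightarrow> 'a symfun \<Rightarrow> 'a symfun"
  is "\<lambda>c f m. c * f m"
proof
  fix c :: 'a and f :: "monomial \<Rightarrow> 'a"
  assume f: "bounded_degree f \<and> permutation_invariant f"
  then show "permutation_invariant (\<lambda>m. c * f m)"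
    by (simp add: permutation_invariant_def)
  from f show "bounded_degree (\<lambda>m. c * f m)"
    unfolding bounded_degree_def by (metis mult_zero_right)
qed

text \<open>The elementary symmetric function: the sum of all squarefree monomials of degree \<open>k\<close>.\<close>

lift_definition elem_sym :: "nat \<Rightarrow> 'a::comm_ring_1 symfun"
  is "\<lambda>k m. if card (Poly_Mapping.keys m) = k \<and> (\<forall>i. Poly_Mapping.lookup m i \<le> 1) then 1 else 0"
proof
  fix k :: nat
  let ?e = "\<lambda>m. if card (Poly_Mapping.keys m) = k \<and> (\<forall>i. Poly_Mapping.lookup m i \<le> 1) then 1 else 0 :: 'a"
  show "bounded_degree ?e"
    unfolding bounded_degree_def
  proof (intro exI[of _ k] allI impI)
    fix m :: monomial assume "?e m \<noteq> 0"
    then have m: "card (Poly_Mapping.keys m) = k" "\<forall>i. Poly_Mapping.lookup m i \<le> 1"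
      by (auto split: if_splits)
    have "mdeg m \<le> (\<Sum>i\<in>Poly_Mapping.keys m. 1)"
      unfolding mdeg_def by (rule sum_mono) (use m in auto)
    then show "mdeg m \<le> k" using m by simp
  qed
  show "permutation_invariant ?e"
    unfolding permutation_invariant_def
  proof (intro allI impI)
    fix \<sigma> :: "nat \<Rightarrow> nat" and m :: monomial assume b: "bij \<sigma>"
    then have i: "inj \<sigma>" "surj \<sigma>" by (auto simp: bij_def)
    have "card (Poly_Mapping.keys (Poly_Mapping.map_key \<sigma> m)) = card (Poly_Mapping.keys m)"
      unfolding keys_map_key[OF i(1)] by (rule card_vimage_inj) (use i in auto)
    moreover have "(\<forall>j. Poly_Mapping.lookup (Poly_Mapping.map_key \<sigma> m) j \<le> 1)
        \<longleftrightarrow> (\<forall>j. Poly_Mapping.lookup m j \<le> 1)"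
      using i by (simp add: map_key.rep_eq) (metis surjD)
    ultimately show "?e (Poly_Mapping.map_key \<sigma> m) = ?e m" by simp
  qed
qed


section \<open>Algebras containing the symmetric functions\<close>

type_synonym ratfun = "rat poly fract"

definition q_indet :: ratfun where
  "q_indet = Fraction_Field.Fract [:0, 1:] 1"

text \<open>Associative unital algebras over a field; commutativity is not required.\<close>

locale unital_algebra = vector_space scale
  for scale :: "'k::field \<Rightarrow> 'a::ring_1 \<Rightarrow> 'a" +
  assumes scale_mult_left: "scale c x * y = scale c (x * y)"
    and scale_mult_right: "x * scale c y = scale c (x * y)"

lemma unital_algebra_symfun: "unital_algebra (symfun_scale :: 'k::field \<Rightarrow> 'k symfun \<Rightarrow> 'k symfun)"
proof
  fix a b :: 'k and x y :: "'k symfun"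
  show "symfun_scale a (x + y) = symfun_scale a x + symfun_scale a y"
    by transfer (simp add: distrib_left)
  show "symfun_scale (a + b) x = symfun_scale a x + symfun_scale b x"
    by transfer (simp add: distrib_right)
  show "symfun_scale a (symfun_scale b x) = symfun_scale (a * b) x"
    by transfer (simp add: mult.assoc)
  show "symfun_scale 1 x = x"
    by transfer simp
  show "symfun_scale a x * y = symfun_scale a (x * y)"
    by transfer (simp add: case_prod_unfold sum_distrib_left mult.assoc)
  show "x * symfun_scale a y = symfun_scale a (x * y)"
    by transfer (simp add: case_prod_unfold sum_distrib_left mult.left_commute)
qed

text \<open>
  ``\<open>A\<close> contains the symmetric functions'' means that they are identified with a unital subalgebra
  of \<open>A\<close> by an injective algebra homomorphism \<open>\<iota>\<close>.
\<close>

definition symfun_embedding :: "('k::field \<Rightarrow> 'a::ring_1 \<Rightarrow> 'a) \<Rightarrow> ('k symfun \<Rightarrow> 'a) \<Rightarrow> bool" where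
  "symfun_embedding scale \<iota> \<longleftrightarrow>
     inj \<iota> \<and> \<iota> 1 = 1 \<and>
     (\<forall>f g. \<iota> (f + g) = \<iota> f + \<iota> g) \<and>
     (\<forall>f g. \<iota> (f * g) = \<iota> f * \<iota> g) \<and>
     (\<forall>c f. \<iota> (symfun_scale c f) = scale c (\<iota> f))"


section \<open>Schroeder paths\<close>

datatype step = North | East | Diag

type_synonym path = "step list"

type_synonym point = "int \<times> int"

fun step_vec :: "step \<Rightarrow> point" where
  "step_vec North = (0, 1)"
| "step_vec East = (1, 0)"
| "step_vec Diag = (1, 1)"

definition path_end :: "path \<Rightarrow> point" where
  "path_end w = ((\<Sum>s\<leftarrow>w. fst (step_vec s)), (\<Sum>s\<leftarrow>w. snd (step_vec s)))"

definition schroeder_path :: "nat \<Rightarrow> path \<Rightarrow> bool" where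
  "schroeder_path n P \<longleftrightarrow>
     path_end P = (int n, int n) \<and>
     (\<forall>U s V. P = U @ [s] @ V \<and> s \<in> {East, Diag} \<longrightarrow> count_list U East < count_list U North)"

definition SCH :: "path set" where
  "SCH = {P. \<exists>n. schroeder_path n P}"

text \<open>
  The lattice points on a path are the endpoints of its prefixes, since no step has a lattice
  point in its interior.
\<close>

definition on_path :: "path \<Rightarrow> point \<Rightarrow> bool" where
  "on_path P p \<longleftrightarrow> (\<exists>U V. P = U @ V \<and> path_end U = p)"

definition incident_north_east :: "path \<Rightarrow> point \<Rightarrow> bool" where
  "incident_north_east P p \<longleftrightarrow>
     (\<exists>U s V. P = U @ [s] @ V \<and> s \<in> {North, East} \<and> (path_end U = p \<or> path_end (U @ [s]) = p))"

definition between_diagonals :: "path \<Rightarrow> point \<Rightarrow> bool" where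
  "between_diagonals P p \<longleftrightarrow> (\<exists>U V. P = U @ [Diag, Diag] @ V \<and> path_end (U @ [Diag]) = p)"

text \<open>
  \<open>first_west P (x, y) u\<close>: moving west from \<open>(x, y)\<close>, the first point of \<open>P\<close> is \<open>(u, y)\<close>.  Only
  lattice points matter, because a path meets an integral height either in lattice points or in
  east steps, whose endpoints are lattice points.
\<close>

definition first_west :: "path \<Rightarrow> point \<Rightarrow> int \<Rightarrow> bool" where
  "first_west P p u \<longleftrightarrow>
     u \<le> fst p \<and> on_path P (u, snd p) \<and> (\<forall>v. u < v \<and> v \<le> fst p \<longrightarrow> \<not> on_path P (v, snd p))"

text \<open>
  \<open>bounce_path P p bs r\<close>: the bounce path of \<open>P\<close> at \<open>p\<close> has the list \<open>bs\<close> of bounce points and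
  ends at \<open>r\<close>.
\<close>

inductive bounce_path :: "path \<Rightarrow> point \<Rightarrow> point list \<Rightarrow> point \<Rightarrow> bool" for P :: path where
  stop: "\<lbrakk>on_path P (u1, u0); first_west P (u1, u1) u2; incident_north_east P (u2, u1)\<rbrakk>
    \<Longrightarrow> bounce_path P (u1, u0) [(u1, u1)] (u2, u1)"
| continue: "\<lbrakk>on_path P (u1, u0); first_west P (u1, u1) u2; between_diagonals P (u2, u1);
     bounce_path P (u2, u1) bs r\<rbrakk>
    \<Longrightarrow> bounce_path P (u1, u0) ((u1, u1) # bs) r"

definition bounce_decomposition ::
    "path \<Rightarrow> point \<Rightarrow> path \<Rightarrow> step \<Rightarrow> step \<Rightarrow> path \<Rightarrow> step \<Rightarrow> step \<Rightarrow> path \<Rightarrow> bool" where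
  "bounce_decomposition P p U s1 s2 V s3 s4 W \<longleftrightarrow>
     P = U @ [s1, s2] @ V @ [s3, s4] @ W \<and>
     (\<exists>bs. bounce_path P p bs (path_end (U @ [s1]))) \<and>
     path_end (U @ [s1, s2] @ V @ [s3]) = p"

text \<open>
  Pitfall: the relation for bounce decompositions \<open>P = U s \<cdot> t V d \<cdot> e W\<close> (one bounce point and
  \<open>st = nn\<close> or \<open>st = dn\<close>) has to be imposed for arbitrary words \<open>V\<close> if it is to characterise a
  function on \<open>SCH\<close>.  If \<open>V\<close> is not allowed to contain east steps, then adding to a solution
  a multiple, by an \<open>\<epsilon>\<close> with \<open>\<epsilon>\<^sup>2 = 0\<close> and \<open>\<epsilon> e\<^sub>k = 0\<close> for \<open>k \<ge> 1\<close>, of the function given by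
  \<open>nnddee \<mapsto> 1\<close>, \<open>nndneee, nnnedee \<mapsto> q - 1\<close>, \<open>nnneneee \<mapsto> (q - 1)\<^sup>2\<close>, \<open>nnndeee \<mapsto> q (q - 1)\<close>,
  \<open>nnnneeee \<mapsto> (q + 1) (q - 1)\<^sup>2\<close>, and \<open>0\<close> otherwise, gives another solution.
\<close>

text \<open>
  Multiplicativity is that of a homomorphism of monoids.  The clause for the empty path follows
  from the other one if \<open>A\<close> has no zero divisors, but not in general.
\<close>

definition multiplicative :: "(path \<Rightarrow> 'a::monoid_mult) \<Rightarrow> bool" where
  "multiplicative F \<longleftrightarrow> F [] = 1 \<and> (\<forall>P\<in>SCH. \<forall>Q\<in>SCH. F (P @ Q) = F P * F Q)"

end

theory Submission
  imports Defs "HOL-Library.Function_Algebras"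
begin

text \<open>
  The hypotheses of (iv) say that \<open>P = U s n V d e W\<close> where the height reached by \<open>U s\<close> is the abscissa
  reached by \<open>U s n V d\<close>, and that at least two more north than east steps precede the displayed
  \<open>e\<close>; the word \<open>V\<close> is arbitrary.

  Uniqueness.  Induct on the number of north steps, then on the length of the prefix \<open>u\<close> before the
  first east step.  If \<open>u\<close> ends in \<open>n\<close>, apply (iii); if \<open>u = n d\<^sup>k\<close>, split off \<open>n d\<^sup>k e\<close>.  Otherwise
  \<open>u = v d\<close>, and with \<open>x\<close> the number of diagonal steps of \<open>u\<close> we look at the letters \<open>x\<close> and \<open>x + 1\<close> of
  \<open>v\<close>.  The cases \<open>nn\<close> and \<open>dn\<close> are (iv).  Abbreviating the two pairs of letters that change, (iii) and
  (iv) imply \<open>[nd, de] = (q - 1) [dn, de] + q [dn, ed]\<close>, and \<open>[dn, de] = [nd, ed]\<close>.  In the case \<open>dd\<close> the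
  bounce path continues to a shorter prefix; writing the second \<open>d\<close> as \<open>(ne - en) / (q - 1)\<close> reduces
  the relation with several bounce points to (iv) and the relation for that shorter prefix.  This
  uses (iv) with east steps in \<open>V\<close>.

  Existence.  Take the vertical-strip LLT polynomial: a sum over colourings of the rows, in which a
  cell of the diagram is weighted by \<open>q\<close> if it is an ascent and a diagonal step forces an ascent.
  Relation (iv) follows by exchanging the colours of two consecutive rows.  That the result is a
  symmetric function follows from the uniqueness argument applied modulo the symmetric functions.
\<close>

section \<open>Schroeder paths and their surplus\<close>

text \<open>The height above the diagonal, run as a partial automaton that rejects a word once an
  east or diagonal step is made on the diagonal. Concatenation becomes composition, so membership in
  \<open>SCH\<close> of words with displayed letters is a computation.\<close>

fun surplus :: "nat \<Rightarrow> path \<Rightarrow> nat option" where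
  "surplus h [] = Some h"
| "surplus h (North # w) = surplus (Suc h) w"
| "surplus 0 (East # w) = None"
| "surplus (Suc h) (East # w) = surplus h w"
| "surplus 0 (Diag # w) = None"
| "surplus (Suc h) (Diag # w) = surplus (Suc h) w"

lemma surplus_append [simp]: "surplus h (A @ B) = Option.bind (surplus h A) (\<lambda>k. surplus k B)"
  by (induction h A rule: surplus.induct) auto

lemma surplus_count:
  "surplus h P = Some k \<Longrightarrow> k + count_list P East = h + count_list P North"
  by (induction h P rule: surplus.induct) auto

lemma surplus_iff:
  "surplus h P = Some k \<longleftrightarrow>
     (\<forall>U s V. P = U @ s # V \<and> s \<in> {East, Diag} \<longrightarrow> count_list U East < h + count_list U North) \<and>
     k + count_list P East = h + count_list P North"
proof (intro iffI conjI allI impI)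
  fix U s V
  assume "surplus h P = Some k" and P: "P = U @ s # V \<and> s \<in> {East, Diag}"
  then obtain l where l: "surplus h U = Some l" "surplus l (s # V) = Some k"
    by (auto simp: bind_eq_Some_conv)
  then have "l \<noteq> 0"
    using P by (cases l) auto
  then show "count_list U East < h + count_list U North"
    using surplus_count[OF l(1)] by simp
next
  assume "surplus h P = Some k"
  then show "k + count_list P East = h + count_list P North"
    by (rule surplus_count)
next
  assume "(\<forall>U s V. P = U @ s # V \<and> s \<in> {East, Diag} \<longrightarrow> count_list U East < h + count_list U North) \<and>
     k + count_list P East = h + count_list P North"
  then show "surplus h P = Some k"
  proof (induction h P rule: surplus.induct)
    case (2 h w)
    have "count_list U East < Suc h + count_list U North" if "w = U @ s # V" "s \<in> {East, Diag}" for U s V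
      using that 2(2)[THEN conjunct1, rule_format, of "North # U" s V] by auto
    then show ?case using 2 by simp
  next
    case (3 w)
    then show ?case by (metis append_Nil count_list.simps(1) insertI1 less_nat_zero_code add_0)
  next
    case (4 h w)
    have "count_list U East < h + count_list U North" if "w = U @ s # V" "s \<in> {East, Diag}" for U s V
      using that 4(2)[THEN conjunct1, rule_format, of "East # U" s V] by auto
    then show ?case using 4 by simp
  next
    case (5 w)
    then show ?case by (metis append_Nil count_list.simps(1) insertI1 insertI2 less_nat_zero_code add_0)
  next
    case (6 h w)
    have "count_list U East < Suc h + count_list U North" if "w = U @ s # V" "s \<in> {East, Diag}" for U s V
      using that 6(2)[THEN conjunct1, rule_format, of "Diag # U" s V] by auto
    then show ?case using 6 by simp
  qed auto
qed

definition rows :: "path \<Rightarrow> nat" where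
  "rows w = count_list w North + count_list w Diag"

definition cols :: "path \<Rightarrow> nat" where
  "cols w = count_list w East + count_list w Diag"

lemma rows_simps [simp]:
  "rows [] = 0" "rows (North # w) = Suc (rows w)" "rows (East # w) = rows w"
  "rows (Diag # w) = Suc (rows w)" "rows (v @ w) = rows v + rows w"
  by (simp_all add: rows_def)

lemma cols_simps [simp]:
  "cols [] = 0" "cols (North # w) = cols w" "cols (East # w) = Suc (cols w)"
  "cols (Diag # w) = Suc (cols w)" "cols (v @ w) = cols v + cols w"
  by (simp_all add: cols_def)

lemma path_end_eq: "path_end w = (int (cols w), int (rows w))"
proof (induction w)
  case (Cons s w)
  then show ?case by (cases s) (auto simp: path_end_def)
qed (simp add: path_end_def)

lemma surplus_rows_cols: "surplus h w = Some k \<Longrightarrow> k + cols w = h + rows w"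
  using surplus_count[of h w k] by (simp add: rows_def cols_def)

lemma SCH_iff: "P \<in> SCH \<longleftrightarrow> surplus 0 P = Some 0"
  by (auto simp: SCH_def schroeder_path_def surplus_iff path_end_eq rows_def cols_def
      simp flip: of_nat_add)

lemma SCH_append: "P \<in> SCH \<Longrightarrow> Q \<in> SCH \<Longrightarrow> P @ Q \<in> SCH"
  by (simp add: SCH_iff)

lemma set_no_East: "East \<notin> set w \<Longrightarrow> set w \<subseteq> {North, Diag}"
proof
  fix s assume "East \<notin> set w" "s \<in> set w"
  then show "s \<in> {North, Diag}" by (cases s) auto
qed

text \<open>Each letter other than an east step climbs one row, so the first \<open>i\<close>
  letters of such a word end at height \<open>i\<close>. This turns the height of a bounce point
  into a position in the word.\<close>

lemma surplus_eq_length: "surplus h w = Some k \<Longrightarrow> set w \<subseteq> {North, Diag} \<Longrightarrow> length w = rows w \<and> k = h + count_list w North"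
  by (induction h w rule: surplus.induct) auto

section \<open>Linear consequences of the bounce relations\<close>

text \<open>Only linear relations are assumed, with values in any vector space, so that the locale
  applies both to the difference of two solutions and to power series not yet known to be symmetric.
  Relation (iv) is stated by counting: the bounce path goes west at height
  \<open>cols (U @ s # North # V) + 1\<close>, which must be the height reached after
  \<open>s\<close>, and \<open>2 \<le> k\<close> expresses x + 1 < z.\<close>

locale bounce_relations = vector_space scale
  for scale :: "'k::field \<Rightarrow> 'v::ab_group_add \<Rightarrow> 'v" +
  fixes q :: 'k and F :: "path \<Rightarrow> 'v"
  assumes q_neq_1: "q \<noteq> 1"
    and unicellular: "U @ Diag # V \<in> SCH \<Longrightarrow>
      F (U @ North # East # V) - F (U @ East # North # V) = scale (q - 1) (F (U @ Diag # V))"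
    and bounce_nn: "\<lbrakk>surplus 0 (U @ North # North # V) = Some k; 2 \<le> k;
      rows U = cols (U @ North # North # V); U @ North # North # V @ Diag # East # W \<in> SCH\<rbrakk> \<Longrightarrow>
      F (U @ North # North # V @ Diag # East # W) = scale q (F (U @ North # North # V @ East # Diag # W))"
    and bounce_dn: "\<lbrakk>surplus 0 (U @ Diag # North # V) = Some k; 2 \<le> k;
      rows U = cols (U @ Diag # North # V); U @ Diag # North # V @ Diag # East # W \<in> SCH\<rbrakk> \<Longrightarrow>
      F (U @ Diag # North # V @ Diag # East # W) = F (U @ North # Diag # V @ East # Diag # W)"
begin

section \<open>Sliding a diagonal step past an east step\<close>

lemma unicellular_add:
  "surplus 0 (U @ Diag # V) = Some 0 \<Longrightarrow>
     F (U @ North # East # V) = F (U @ East # North # V) + scale (q - 1) (F (U @ Diag # V))"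
  using unicellular[of U V] by (simp add: SCH_iff algebra_simps)

text \<open>A rule for rewriting \<open>A\<close> followed by de, uniform in the continuation. For
  prefixes without east steps and of equal length, the term ending in ed is the simpler one, since
  its first east step comes earlier.\<close>

definition slides :: "'k \<Rightarrow> 'k \<Rightarrow> path \<Rightarrow> path \<Rightarrow> bool" where
  "slides a b A B \<longleftrightarrow> (\<forall>W. A @ Diag # East # W \<in> SCH \<longrightarrow>
     F (A @ Diag # East # W) = scale a (F (B @ Diag # East # W)) + scale b (F (B @ East # Diag # W)))"

lemma slides_nn:
  assumes "surplus 0 (U @ North # North # V) = Some k" "2 \<le> k" "rows U = cols (U @ North # North # V)"
  shows "slides 0 q (U @ North # North # V) (U @ North # North # V)"
  using bounce_nn[OF assms] by (simp add: slides_def)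

lemma slides_dn:
  assumes "surplus 0 (U @ Diag # North # V) = Some k" "2 \<le> k" "rows U = cols (U @ Diag # North # V)"
  shows "slides 0 1 (U @ Diag # North # V) (U @ North # Diag # V)"
  using bounce_dn[OF assms] by (simp add: slides_def)

text \<open>After multiplication by \<open>q - 1\<close>, the displayed d is traded for ne - en by
  (iii). The words with nne and enn fall under (iv); returning by (iii) and by (iv) for dn, the enn
  terms cancel and the factor \<open>q - 1\<close> can be divided out.\<close>

lemma slides_nd:
  assumes sp: "surplus 0 (U @ Diag # North # V) = Some k" "2 \<le> k"
    and rc: "rows U = cols (U @ North # Diag # V)"
  shows "slides (q - 1) q (U @ North # Diag # V) (U @ Diag # North # V)"
  unfolding slides_def
proof (intro allI impI)
  fix W
  assume W: "(U @ North # Diag # V) @ Diag # East # W \<in> SCH"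
  obtain h where h: "surplus 0 U = Some (Suc h)" "surplus (Suc (Suc h)) V = Some k"
  proof (cases "surplus 0 U")
    case (Some h)
    then show ?thesis using that sp by (cases h) auto
  qed (use sp in auto)
  obtain l where k: "k = Suc (Suc l)" using sp(2) by (metis add_2_eq_Suc le_Suc_ex)
  have sW: "surplus (Suc l) W = Some 0"
    using W h by (simp add: SCH_iff k)
  let ?de = "V @ Diag # East # W" and ?ed = "V @ East # Diag # W"
  have "scale (q - 1) (F (U @ North # Diag # ?de)) = F (U @ North # North # East # ?de) - F (U @ North # East # North # ?de)"
    using unicellular[of "U @ [North]" ?de] h sW by (simp add: SCH_iff k)
  \<comment> \<open>The east step is counted with the middle word: nne has as many columns as nd, so
    the counting condition persists.\<close>
  also have "F (U @ North # North # East # ?de) = scale q (F (U @ North # North # East # ?ed))"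
    using bounce_nn[of U "East # V" k W] h sW rc by (simp add: SCH_iff k)
  finally have 1: "scale (q - 1) (F (U @ North # Diag # ?de)) =
    scale q (F (U @ North # North # East # ?ed)) - F (U @ North # East # North # ?de)" .
  have "F (U @ North # East # North # ?de) - scale q (F (U @ East # North # North # ?ed)) =
     F (U @ North # East # North # ?de) - F (U @ East # North # North # ?de)"
    using bounce_nn[of "U @ [East]" V k W] h sW rc by (simp add: SCH_iff k)
  also have "\<dots> = scale (q - 1) (F (U @ Diag # North # ?de))"
    using unicellular[of U "North # ?de"] h sW by (simp add: SCH_iff k)
  finally have 2: "F (U @ North # East # North # ?de) =
    scale (q - 1) (F (U @ Diag # North # ?de)) + scale q (F (U @ East # North # North # ?ed))"
    by (simp add: algebra_simps)
  have "scale (q - 1) (F (U @ Diag # North # ?de)) = scale (q - 1) (F (U @ North # Diag # ?ed))"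
    using bounce_dn[of U V k W] h sW rc by (simp add: SCH_iff k)
  also have "\<dots> = F (U @ North # North # East # ?ed) - F (U @ North # East # North # ?ed)"
    using unicellular[of "U @ [North]" ?ed] h sW by (simp add: SCH_iff k)
  finally have 3: "F (U @ North # North # East # ?ed) =
    scale (q - 1) (F (U @ Diag # North # ?de)) + F (U @ North # East # North # ?ed)" by (simp add: algebra_simps)
  have 4: "F (U @ North # East # North # ?ed) =
    F (U @ East # North # North # ?ed) + scale (q - 1) (F (U @ Diag # North # ?ed))"
    using unicellular[of U "North # ?ed"] h sW by (simp add: SCH_iff k algebra_simps)
  have "scale (q - 1) (F (U @ North # Diag # ?de)) =
    scale (q - 1) (scale (q - 1) (F (U @ Diag # North # ?de)) + scale q (F (U @ Diag # North # ?ed)))"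
    unfolding 1 2 3 4 by (simp add: algebra_simps scale_right_distrib scale_left_distrib scale_left_diff_distrib)
  then show "F ((U @ North # Diag # V) @ Diag # East # W) =
    scale (q - 1) (F ((U @ Diag # North # V) @ Diag # East # W)) +
    scale q (F ((U @ Diag # North # V) @ East # Diag # W))"
    using q_neq_1 by simp
qed

text \<open>The second d is traded for ne - en. In the ne term, (iv) for dn moves the later de to ed
  and creates de after \<open>A @ [North]\<close>, where the second rule applies; in the en term the
  first rule applies directly after \<open>A\<close>. Reversing such moves with \<open>B\<close> in
  place of \<open>A\<close> restores the two diagonal steps.\<close>

lemma slides_dd:
  assumes sl: "slides a b A B" "slides a b (A @ [North]) (B @ [North])"
    and sp: "surplus 0 A = Some k" "surplus 0 B = Some k" "2 \<le> k" "surplus k V = Some l" "2 \<le> l"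
    and rc: "rows B = rows A" "cols B = cols A" "rows A = cols (A @ Diag # Diag # V)"
  shows "slides a b (A @ Diag # Diag # V) (B @ Diag # Diag # V)"
  unfolding slides_def
proof (intro allI impI)
  fix W
  assume W: "(A @ Diag # Diag # V) @ Diag # East # W \<in> SCH"
  obtain k' where k: "k = Suc (Suc k')" using sp(3) by (metis add_2_eq_Suc le_Suc_ex)
  obtain l' where l: "l = Suc (Suc l')" using sp(5) by (metis add_2_eq_Suc le_Suc_ex)
  have sV: "surplus (Suc (Suc k')) V = Some (Suc (Suc l'))" using sp k l by simp
  have sW: "surplus (Suc l') W = Some 0"
    using W sp by (simp add: SCH_iff k l)
  let ?de = "V @ Diag # East # W" and ?ed = "V @ East # Diag # W"
  note s = SCH_iff k l sp(1,2) sV sW rc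
  have dn: "F (C @ Diag # North # East # ?de) = F (C @ North # Diag # East # ?ed)"
    if "C \<in> {A, B}" for C
    using bounce_dn[of C "East # V" l W] that by (auto simp: s)
  \<comment> \<open>The terms with coefficient \<open>b\<close> can have their east step right after
    \<open>B\<close>, so (iv) is used with \<open>B @ [East]\<close> as initial word.\<close>
  have dn': "F (B @ East # Diag # North # ?de) = F (B @ East # North # Diag # ?ed)"
    using bounce_dn[of "B @ [East]" V l W] rc by (auto simp: s)
  have dd: "scale (q - 1) (F (C @ Diag # Diag # ?de)) =
      F (C @ Diag # North # East # ?de) - F (C @ Diag # East # North # ?de)"
    if "C \<in> {A, B}" for C
    using unicellular[of "C @ [Diag]" ?de] that by (auto simp: s)
  have dd': "scale (q - 1) (F (B @ Diag # Diag # ?ed)) =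
      F (B @ North # East # Diag # ?ed) - F (B @ East # North # Diag # ?ed)"
    using unicellular[of B "Diag # ?ed"] by (auto simp: s)
  have s1: "F (A @ North # Diag # East # ?ed) =
      scale a (F (B @ North # Diag # East # ?ed)) + scale b (F (B @ North # East # Diag # ?ed))"
    using sl(2) by (auto simp: slides_def s)
  have s2: "F (A @ Diag # East # North # ?de) =
      scale a (F (B @ Diag # East # North # ?de)) + scale b (F (B @ East # Diag # North # ?de))"
    using sl(1) by (auto simp: slides_def s)
  have "scale (q - 1) (F (A @ Diag # Diag # ?de)) =
      scale a (F (B @ Diag # North # East # ?de) - F (B @ Diag # East # North # ?de)) +
      scale b (F (B @ North # East # Diag # ?ed) - F (B @ East # North # Diag # ?ed))"
    using dd[of A] dn[of A] dn[of B] dn' s1 s2 by (simp add: algebra_simps)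
  also have "\<dots> = scale (q - 1)
      (scale a (F (B @ Diag # Diag # ?de)) + scale b (F (B @ Diag # Diag # ?ed)))"
    unfolding dd[of B, simplified, symmetric] dd'[symmetric] by (simp add: scale_right_distrib mult.commute)
  finally show "F ((A @ Diag # Diag # V) @ Diag # East # W) =
    scale a (F ((B @ Diag # Diag # V) @ Diag # East # W)) + scale b (F ((B @ Diag # Diag # V) @ East # Diag # W))"
    using q_neq_1 by simp
qed

text \<open>\<open>slides_dd\<close> consumes the rule for a prefix and for its extension by a north
  step. The pair is inherited, because that extension amounts to appending the north step to
  \<open>V\<close>.\<close>

definition slides2 :: "'k \<Rightarrow> 'k \<Rightarrow> path \<Rightarrow> path \<Rightarrow> bool" where
  "slides2 a b A B \<longleftrightarrow> slides a b A B \<and> slides a b (A @ [North]) (B @ [North])"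

text \<open>Recursion along the bounce path. If \<open>a\<close> is nonzero, the right side still
  contains de after a prefix of the same length; the reverse rule from \<open>B\<close> to
  \<open>v\<close> is carried along to finish the rewriting.\<close>

lemma ex_slides:
  assumes "set v \<subseteq> {North, Diag}" "surplus 0 v = Some k" "2 \<le> k"
  shows "\<exists>a b B. set B \<subseteq> {North, Diag} \<and> surplus 0 B = Some k \<and> length B = length v \<and>
    slides2 a b v B \<and> (a = 0 \<or> slides2 0 1 B v)"
  using assms
proof (induction "length v" arbitrary: v k rule: less_induct)
  case less
  note v = less.prems
  have lv: "length v = rows v" "rows v = k + cols v"
    using surplus_eq_length[OF v(2,1)] surplus_rows_cols[OF v(2)] by auto
  \<comment> \<open>After \<open>v\<close> and one more diagonal step the abscissa is
    \<open>cols v + 1\<close>, and the first \<open>cols v + 1\<close> letters of \<open>v\<close>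
    end at that height. So \<open>s\<close> and \<open>t\<close> are the letters around the point
    where the bounce path arrives; both exist because \<open>length v = k + cols v\<close> and
    \<open>2 \<le> k\<close>.\<close>
  define U s t V where "U = take (cols v) v" and "s = v ! cols v" and "t = v ! Suc (cols v)"
    and "V = drop (Suc (Suc (cols v))) v"
  have vU: "v = U @ s # t # V"
    using lv v(3) unfolding U_def s_def t_def V_def
    by (simp add: Cons_nth_drop_Suc)
  have lU: "length U = cols v"
    using lv by (simp add: U_def)
  obtain h where h: "surplus 0 U = Some h"
    using v(2) vU by (cases "surplus 0 U") auto
  have setU: "set U \<subseteq> {North, Diag}" using v(1) vU by auto
  have rU: "rows U = cols v" "rows U = h + cols U"
    using surplus_eq_length[OF h setU] surplus_rows_cols[OF h] lU by auto
  have vN: "surplus 0 (v @ [North]) = Some (Suc k)" using v(2) by simp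
  consider "s = North" "t = North" | "s = Diag" "t = North" | "s = North" "t = Diag" | "s = Diag" "t = Diag"
    using v(1) vU by (cases s; cases t) auto
  then show ?case
  proof cases
    case 1
    have sp: "surplus 0 (U @ North # North # V) = Some k"
      "surplus 0 (U @ North # North # (V @ [North])) = Some (Suc k)"
      using v(2) vN unfolding vU 1 by simp_all
    have "slides2 0 q v v"
      using slides_nn[OF sp(1)] slides_nn[OF sp(2)] v(3) rU vU 1 by (simp add: slides2_def)
    then show ?thesis using v by blast
  next
    case 2
    have sp: "surplus 0 (U @ Diag # North # V) = Some k"
      "surplus 0 (U @ Diag # North # (V @ [North])) = Some (Suc k)"
      using v(2) vN unfolding vU 2 by simp_all
    have "slides2 0 1 v (U @ North # Diag # V)"
      using slides_dn[OF sp(1)] slides_dn[OF sp(2)] v(3) rU vU 2 by (simp add: slides2_def)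
    moreover have "surplus 0 (U @ North # Diag # V) = Some k"
      using sp(1) h by (cases h) auto
    moreover have "set (U @ North # Diag # V) \<subseteq> {North, Diag}" "length (U @ North # Diag # V) = length v"
      using v(1) vU by auto
    ultimately show ?thesis by blast
  next
    case 3
    obtain h' where h': "h = Suc h'"
      using rU vU 3 by (cases h) auto
    have sp: "surplus 0 (U @ Diag # North # V) = Some k"
      "surplus 0 (U @ Diag # North # (V @ [North])) = Some (Suc k)"
      using v(2) vN h h' unfolding vU 3 by simp_all
    have "slides2 (q - 1) q v (U @ Diag # North # V)"
      using slides_nd[OF sp(1)] slides_nd[OF sp(2)] v(3) rU vU 3 by (simp add: slides2_def)
    moreover have "slides2 0 1 (U @ Diag # North # V) v"
      using slides_dn[OF sp(1)] slides_dn[OF sp(2)] v(3) rU vU 3 by (simp add: slides2_def)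
    moreover have "set (U @ Diag # North # V) \<subseteq> {North, Diag}" "length (U @ Diag # North # V) = length v"
      using v(1) vU by auto
    ultimately show ?thesis using sp(1) by blast
  next
    case 4
    \<comment> \<open>The equation \<open>rows U = cols v\<close> and the two diagonal steps outside
      \<open>U\<close> give \<open>h = cols V + 2\<close>, so the induction hypothesis covers
      \<open>U\<close>.\<close>
    have h2: "2 \<le> h"
      using rU vU 4 by auto
    then have sV: "surplus h V = Some k" "surplus h (V @ [North]) = Some (Suc k)"
      using v(2) vU 4 h by (cases h; simp)+
    obtain a b B where B: "set B \<subseteq> {North, Diag}" "surplus 0 B = Some h" "length B = length U"
      "slides2 a b U B" "a = 0 \<or> slides2 0 1 B U"
      using less.hyps[of U h] setU h h2 vU by auto
    have rc: "rows B = rows U" "cols B = cols U"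
      using B(3) surplus_eq_length[OF h setU] surplus_eq_length[OF B(2,1)]
        surplus_rows_cols[OF h] surplus_rows_cols[OF B(2)] by auto
    have lift: "slides2 a b (C @ Diag # Diag # V) (D @ Diag # Diag # V)"
      if "slides2 a b C D" "surplus 0 C = Some h" "surplus 0 D = Some h"
        "rows C = rows U" "cols C = cols U" "rows D = rows U" "cols D = cols U" for a b C D
      using slides_dd[OF _ _ that(2,3) h2 sV(1), of a b] slides_dd[OF _ _ that(2,3) h2 sV(2), of a b]
        that v(3) rU vU 4 by (simp add: slides2_def)
    have "slides2 a b v (B @ Diag # Diag # V)"
      using lift[OF B(4) h B(2)] rc vU 4 by simp
    moreover have "a = 0 \<or> slides2 0 1 (B @ Diag # Diag # V) v"
      using B(5) lift[OF _ B(2) h] rc vU 4 by auto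
    moreover have "surplus 0 (B @ Diag # Diag # V) = Some k"
      using h2 B(2) sV(1) by (cases h) auto
    moreover have "set (B @ Diag # Diag # V) \<subseteq> {North, Diag}" "length (B @ Diag # Diag # V) = length v"
      using v(1) vU B(1,3) 4 by auto
    ultimately show ?thesis by blast
  qed
qed

section \<open>Generation of all values from hooks\<close>

text \<open>With \<open>S = {0}\<close> and a difference of solutions this gives uniqueness; with
  the symmetric functions among all power series it gives symmetry. Closure under concatenation is a
  hypothesis about \<open>S\<close>, since a difference of multiplicative functions need not be
  multiplicative.\<close>

theorem F_in_subspace:
  assumes S: "subspace S"
    and one: "F [] \<in> S"
    and hook: "\<And>k. F (North # replicate k Diag @ [East]) \<in> S"
    and mult: "\<And>P Q. P \<in> SCH \<Longrightarrow> Q \<in> SCH \<Longrightarrow> F P \<in> S \<Longrightarrow> F Q \<in> S \<Longrightarrow> F (P @ Q) \<in> S"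
    and P: "P \<in> SCH"
  shows "F P \<in> S"
  using P
proof (induction P rule: wf_induct_rule[OF wf_measures[of
      "[\<lambda>P. count_list P North, \<lambda>P. length (takeWhile (\<lambda>s. s \<noteq> East) P)]"]])
  case (1 P)
  have IH: "F Q \<in> S" if "Q \<in> SCH" "count_list Q North < count_list P North \<or>
      count_list Q North = count_list P North \<and>
      length (takeWhile (\<lambda>s. s \<noteq> East) Q) < length (takeWhile (\<lambda>s. s \<noteq> East) P)" for Q
    using 1(1)[of Q] that by auto
  have sP: "surplus 0 P = Some 0" using 1(2) by (simp add: SCH_iff)
  show ?case
  proof (cases "East \<in> set P")
    case False
    then have "set P \<subseteq> {North, Diag}"
      by (rule set_no_East)
    then have "count_list P North = 0" "set P \<subseteq> {North, Diag}"
      using surplus_eq_length[OF sP] by auto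
    then have "P = []"
      using sP by (cases P) (auto simp: count_list_0_iff)
    then show ?thesis using one by simp
  next
    case True
    define u where "u = takeWhile (\<lambda>s. s \<noteq> East) P"
    have IH': "F Q \<in> S" if "Q \<in> SCH" "count_list Q North = count_list P North"
        "length (takeWhile (\<lambda>s. s \<noteq> East) Q) < length u" for Q
      using IH[of Q] that by (simp add: u_def)
    obtain W where W: "P = u @ East # W"
    proof -
      have "dropWhile (\<lambda>s. s \<noteq> East) P \<noteq> []" using True by (auto simp: dropWhile_eq_Nil_conv)
      then show ?thesis
        using that[of "tl (dropWhile (\<lambda>s. s \<noteq> East) P)"] hd_dropWhile[of "\<lambda>s. s \<noteq> East" P]
          takeWhile_dropWhile_id[of "\<lambda>s. s \<noteq> East" P]
        unfolding u_def by (metis list.collapse)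
    qed
    have setu: "set u \<subseteq> {North, Diag}"
      by (rule set_no_East) (auto simp: u_def dest: set_takeWhileD)
    obtain k where k: "surplus 0 u = Some (Suc k)" "surplus k W = Some 0"
    proof (cases "surplus 0 u")
      case (Some k)
      then show ?thesis using that sP W by (cases k) auto
    qed (use sP W in auto)
    have takeWhile_nd: "takeWhile (\<lambda>s. s \<noteq> East) (w @ East # X) = w"
      if "set w \<subseteq> {North, Diag}" for w X
      using that by (subst takeWhile_append2) auto
    have "u \<noteq> []" using k by auto
    then obtain v s where u: "u = v @ [s]" by (metis rev_exhaust)
    have setv: "set v \<subseteq> {North, Diag}" using setu u by auto
    consider "k = 0" | "k \<noteq> 0" "s = North" | "k \<noteq> 0" "s = Diag"
      using setu u by (cases s) auto
    then show ?thesis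
    proof cases
      case 1
      \<comment> \<open>Surplus 1 before the first east step means a single north step, so the path
        starts with a hook that returns to the diagonal.\<close>
      have "count_list u North = 1"
        using surplus_eq_length[OF k(1) setu] 1 by simp
      moreover obtain u' where u': "u = North # u'"
        using \<open>u \<noteq> []\<close> setu k(1) by (cases u; cases "hd u") auto
      ultimately have "set u' \<subseteq> {Diag}"
        using setu by (auto simp: count_list_0_iff)
      then have "u' = replicate (length u') Diag"
        by (metis replicate_eqI singletonD subsetD)
      then have P': "P = (North # replicate (length u') Diag @ [East]) @ W"
        using u' W by simp
      have "North # replicate (length u') Diag @ [East] \<in> SCH"
        using k(1) 1 \<open>u' = _\<close> u' by (auto simp: SCH_iff)
      moreover have "W \<in> SCH" using k 1 by (simp add: SCH_iff)
      moreover have "F W \<in> S"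
        by (rule IH) (use k 1 P' in \<open>auto simp: SCH_iff\<close>)
      ultimately show ?thesis
        unfolding P' by (intro mult hook)
    next
      case 2
      have sv: "surplus 0 v = Some k"
        using k(1) 2 u by (auto simp: bind_eq_Some_conv)
      obtain k' where k': "k = Suc k'" using 2 by (cases k) auto
      \<comment> \<open>Of the two terms of (iii), the first has an earlier first east step and the
        second one north step fewer.\<close>
      have "F P = F (v @ East # North # W) + scale (q - 1) (F (v @ Diag # W))"
        using unicellular_add[of v W] sv k W u 2 k' by simp
      moreover have "F (v @ East # North # W) \<in> S"
        by (rule IH') (use sv k W u 2 k' setv in \<open>auto simp: SCH_iff takeWhile_nd\<close>)
      moreover have "F (v @ Diag # W) \<in> S"
        by (rule IH) (use sv k W u 2 k' in \<open>auto simp: SCH_iff\<close>)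
      ultimately show ?thesis
        using S by (simp add: subspace_add subspace_scale)
    next
      case 3
      have sv: "surplus 0 v = Some (Suc k)"
      proof -
        obtain l where "surplus 0 v = Some l" "surplus l [Diag] = Some (Suc k)"
          using k(1) 3 u by (auto simp: bind_eq_Some_conv)
        then show ?thesis by (cases l) auto
      qed
      obtain k' where k': "k = Suc k'" using 3 by (cases k) auto
      obtain a b B where B: "set B \<subseteq> {North, Diag}" "surplus 0 B = Some (Suc k)" "length B = length v"
        "slides2 a b v B" "a = 0 \<or> slides2 0 1 B v"
        using ex_slides[OF setv sv] k' by auto
      have cB: "count_list B North = count_list v North"
        using surplus_eq_length[OF B(2,1)] surplus_eq_length[OF sv setv] by simp
      have in_S: "F (C @ East # Diag # W) \<in> S" if "C \<in> {v, B}" for C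
        by (rule IH') (use that sv B(1,2,3) cB k W u 3 k' setv in \<open>auto simp: SCH_iff takeWhile_nd\<close>)
      have "F (v @ Diag # East # W) =
          scale a (F (B @ Diag # East # W)) + scale b (F (B @ East # Diag # W))"
        using B(4) sv k k' by (auto simp: slides2_def slides_def SCH_iff)
      \<comment> \<open>This word is as large as \<open>P\<close> in the induction order, so the
        reverse rule is applied before the induction hypothesis.\<close>
      moreover have "scale a (F (B @ Diag # East # W)) \<in> S"
      proof (cases "a = 0")
        case True
        then show ?thesis using S by (simp add: subspace_0)
      next
        case False
        then have "F (B @ Diag # East # W) = F (v @ East # Diag # W)"
          using B(5) B(2) k k' by (auto simp: slides2_def slides_def SCH_iff)
        then show ?thesis using in_S[of v] S by (simp add: subspace_scale)
      qed
      ultimately show ?thesis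
        using in_S[of B] S W u 3 by (simp add: subspace_add subspace_scale)
    qed
  qed
qed

end

section \<open>Bounce paths with one bounce point\<close>

text \<open>A nonempty word has nonzero displacement, so a path visits no point twice.\<close>

lemma prefix_eq_if_path_end_eq:
  assumes "A @ B = A' @ B'" "path_end A = path_end A'"
  shows "A = A'"
proof -
  have "w = []" if "cols w = 0" "rows w = 0" for w
    using that by (cases w; cases "hd w") auto
  then show ?thesis
    using assms by (auto simp: append_eq_append_conv2 path_end_eq)
qed

text \<open>A point of the path determines its neighbouring letters; hence the rules
  \<open>stop\<close> and \<open>continue\<close> of \<open>bounce_path\<close> exclude each
  other.\<close>

lemma not_incident_and_between:
  assumes "incident_north_east P p" "between_diagonals P p"
  shows False
proof -
  obtain U s V where 1: "P = U @ [s] @ V" "s \<in> {North, East}" "path_end U = p \<or> path_end (U @ [s]) = p"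
    using assms(1) by (auto simp: incident_north_east_def)
  obtain U' V' where 2: "P = U' @ [Diag, Diag] @ V'" "path_end (U' @ [Diag]) = p"
    using assms(2) by (auto simp: between_diagonals_def)
  have P: "U @ s # V = (U' @ [Diag]) @ Diag # V'" "(U @ [s]) @ V = (U' @ [Diag]) @ Diag # V'"
    using 1 2 by simp_all
  have "U = U' @ [Diag] \<or> U @ [s] = U' @ [Diag]"
    using prefix_eq_if_path_end_eq[OF P(1)] prefix_eq_if_path_end_eq[OF P(2)] 1(3) 2(2) by auto
  then show False
    using P 1(2) by auto
qed

lemma first_west_unique: "first_west P p u \<Longrightarrow> first_west P p v \<Longrightarrow> u = v"
  by (metis first_west_def linorder_less_linear)

text \<open>\<open>bounce_decomposition\<close> hides its own list of bounce points; this ties its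
  endpoint to the given path with one bounce point. The second derivation must stop at once as
  well.\<close>

lemma single_bounce_height:
  assumes "bounce_path P (x, z) bs r" "length bs = 1" "bounce_path P (x, z) bs' r'"
  shows "snd r' = x"
proof -
  have ne: "cs \<noteq> []" if "bounce_path P p cs r" for p cs r
    using that by cases auto
  obtain u where u: "first_west P (x, x) u" "incident_north_east P (u, x)"
    using assms(1,2) by cases (auto dest: ne)
  from assms(3) show ?thesis
  proof cases
    case (continue u')
    then show ?thesis
      using first_west_unique u not_incident_and_between by blast
  qed auto
qed

lemma single_bounce_counts:
  assumes "bounce_path P (x, z) bs r" "length bs = 1" "x + 1 < z"
    and "bounce_decomposition P (x, z) U s North V Diag East W" "s \<noteq> East"
    and "P \<in> SCH"
  obtains k where "surplus 0 (U @ s # North # V) = Some k" "2 \<le> k" "rows U = cols (U @ s # North # V)"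
proof -
  from assms(4) obtain bs' where P: "P = (U @ s # North # V) @ Diag # East # W"
    and b: "bounce_path P (x, z) bs' (path_end (U @ [s]))"
    and e: "path_end (U @ [s, North] @ V @ [Diag]) = (x, z)"
    by (auto simp: bounce_decomposition_def)
  have "rows (U @ [s]) = nat x"
    using single_bounce_height[OF assms(1,2) b] by (simp add: path_end_eq)
  then have "rows U = cols (U @ s # North # V)"
    using e assms(5) by (cases s) (auto simp: path_end_eq)
  moreover obtain k where k: "surplus 0 (U @ s # North # V) = Some k"
    using assms(6) unfolding SCH_iff P surplus_append[of _ "_ @ _"] by (auto simp: bind_eq_Some_conv)
  moreover have "2 \<le> k"
    using surplus_rows_cols[OF k] e assms(3) by (cases s) (auto simp: path_end_eq)
  ultimately show ?thesis using that by blast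
qed

lemma single_bounceI:
  assumes k: "surplus 0 (U @ s # North # V) = Some k" "2 \<le> k"
    and rc: "rows U = cols (U @ s # North # V)" and s: "s \<noteq> East"
    and P: "P = U @ s # North # V @ Diag # East # W"
  obtains x z where "on_path P (x, z)" "x + 1 < z" "bounce_path P (x, z) [(x, x)] (path_end (U @ [s]))"
    "bounce_decomposition P (x, z) U s North V Diag East W"
proof -
  define w where "w = U @ s # North # V"
  define x z where "x = int (cols w) + 1" and "z = int (rows w) + 1"
  have w: "path_end (w @ [Diag]) = (x, z)"
    by (simp add: path_end_eq x_def z_def)
  have Pw: "P = (w @ [Diag]) @ East # W" "P = (U @ [s]) @ North # V @ Diag # East # W"
    using P by (simp_all add: w_def)
  have on: "on_path P (x, z)"
    unfolding on_path_def using Pw(1) w by blast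
  have lt: "x + 1 < z"
    using surplus_rows_cols[OF k(1)] k(2) by (simp add: x_def z_def w_def)
  have rs: "rows (U @ [s]) = nat x"
    using rc s by (cases s) (auto simp: x_def w_def)
  define y where "y = int (cols (U @ [s]))"
  have ey: "path_end (U @ [s]) = (y, x)"
    using rs by (auto simp: path_end_eq y_def x_def w_def)
  have "first_west P (x, x) y"
    unfolding first_west_def
  proof (intro conjI allI impI)
    show "y \<le> fst (x, x)"
      by (cases s) (auto simp: y_def x_def w_def)
    show "on_path P (y, snd (x, x))"
      unfolding on_path_def snd_conv using Pw(2) ey by blast
    \<comment> \<open>A point at height \<open>x\<close> and east of \<open>y\<close> would lie
      beyond \<open>U @ [s]\<close>, but the next step is north and leaves that height.\<close>
    fix v assume v: "y < v \<and> v \<le> fst (x, x)"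
    show "\<not> on_path P (v, snd (x, x))"
    proof
      assume "on_path P (v, snd (x, x))"
      then obtain A B where A: "P = A @ B" "path_end A = (v, x)"
        by (auto simp: on_path_def)
      have c: "int (cols A) = v" "int (rows A) = x"
        using A(2) by (auto simp: path_end_eq)
      from A(1) Pw(2) have "A @ B = (U @ [s]) @ North # V @ Diag # East # W" by simp
      then consider us where "A @ us = U @ [s]"
        | us where "A = (U @ [s]) @ us" "us @ B = North # V @ Diag # East # W"
        unfolding append_eq_append_conv2 by metis
      then show False
      proof cases
        case 1
        then have "cols A + cols us = cols (U @ [s])" by (metis cols_simps(5))
        then show ?thesis using v c by (simp add: y_def)
      next
        case 2
        have "us = [] \<or> hd us = North" using 2(2) by (cases us) auto
        then have "cols A = cols (U @ [s]) \<or> rows A > rows (U @ [s])"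
          using 2(1) by (cases us; cases s) auto
        then show ?thesis using v c rs by (auto simp: y_def)
      qed
    qed
  qed
  moreover have "incident_north_east P (y, x)"
  proof -
    have "P = (U @ [s]) @ [North] @ (V @ Diag # East # W)" using P by simp
    then show ?thesis unfolding incident_north_east_def using ey by blast
  qed
  ultimately have b: "bounce_path P (x, z) [(x, x)] (path_end (U @ [s]))"
    unfolding ey by (rule bounce_path.stop[OF on])
  moreover have "bounce_decomposition P (x, z) U s North V Diag East W"
    unfolding bounce_decomposition_def using b w P by (auto simp: w_def)
  ultimately show ?thesis using that on lt by blast
qed

section \<open>Vertical-strip LLT polynomials\<close>

definition below :: "nat list \<Rightarrow> nat \<Rightarrow> nat" where
  "below Q c = length (filter (\<lambda>i. i < c) Q)"

lemma below_simps [simp]: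
  "below [] c = 0" "below (a # Q) c = of_bool (a < c) + below Q c"
  "below (Q @ R) c = below Q c + below R c"
  by (simp_all add: below_def)

text \<open>
  The list holds the colours of the rows whose column has not been passed yet, oldest row first: a
  new row forms cells with exactly these rows, and a diagonal step forces the ascent in its own cell,
  which then carries no weight.
\<close>

fun llt :: "'k::field \<Rightarrow> nat list \<Rightarrow> path \<Rightarrow> monomial \<Rightarrow> 'k" where
  "llt q Q [] m = of_bool (Q = [] \<and> m = 0)"
| "llt q Q (North # w) m =
     (\<Sum>c\<in>Poly_Mapping.keys m. q ^ below Q c * llt q (Q @ [c]) w (m - Poly_Mapping.single c 1))"
| "llt q [] (East # w) m = 0"
| "llt q (a # Q) (East # w) m = llt q Q w m"
| "llt q [] (Diag # w) m = 0"
| "llt q (a # Q) (Diag # w) m =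
     (\<Sum>c\<in>Poly_Mapping.keys m. of_bool (a < c) * q ^ below Q c * llt q (Q @ [c]) w (m - Poly_Mapping.single c 1))"

text \<open>Indicators are kept as factors, so that linear identities can be checked summand by
  summand.\<close>

declare sum_of_bool_eq [simp del] sum_mult_of_bool_eq [simp del] sum_of_bool_mult_eq [simp del]

text \<open>A prefix acts on the list and the monomial in the same way whatever follows, so linear
  relations between continuations pass through it. The surplus is the length of the list that the
  continuation receives.\<close>

lemma llt_prefix:
  assumes "surplus (length Q) U = Some j"
    and "\<And>R m. length R = j \<Longrightarrow> llt q R X m = a * llt q R Y m + b * llt q R Z m"
  shows "llt q Q (U @ X) m = a * llt q Q (U @ Y) m + b * llt q Q (U @ Z) m"
  using assms(1)
proof (induction U arbitrary: Q m)
  case Nil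
  then show ?case using assms(2) by simp
next
  case (Cons s w)
  show ?case
  proof (cases s)
    case North
    then show ?thesis
      using Cons by (simp add: sum.distrib sum_distrib_left distrib_left mult.left_commute mult.assoc)
  next
    case East
    then show ?thesis using Cons by (cases Q) auto
  next
    case Diag
    then show ?thesis
      using Cons by (cases Q) (simp_all add: sum.distrib sum_distrib_left distrib_left mult.left_commute mult.assoc)
  qed
qed

text \<open>
  The scalars are the weights of the cells that see only one of the two exchanged colours \<open>x\<close>, \<open>y\<close>; all
  cells created during \<open>V\<close> are insensitive to the exchange.
\<close>

lemma llt_swap:
  assumes coeff: "\<And>c. a * of_bool (x < c) * q ^ of_bool (y < c) + b * of_bool (y < c) * q ^ of_bool (x < c) =
      a' * of_bool (y < c) + b' * of_bool (x < c)"
    and "cols V = length Q"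
  shows "a * llt q (Q @ x # y # R) (V @ Diag # East # W) m + b * llt q (Q @ y # x # R) (V @ Diag # East # W) m =
    a' * llt q (Q @ x # y # R) (V @ East # Diag # W) m + b' * llt q (Q @ y # x # R) (V @ East # Diag # W) m"
  using assms(2)
proof (induction V arbitrary: Q R m)
  case Nil
  \<comment> \<open>\<open>Q\<close> is empty here. In de the new row \<open>c\<close> is forced
    above the first of the two colours and weighted by the second; in ed the first is dropped and
    \<open>c\<close> is forced above the second. Both leave the list \<open>R @ [c]\<close>.\<close>
  define g where "g c = q ^ below R c * llt q (R @ [c]) W (m - Poly_Mapping.single c 1)" for c
  have "a * llt q (x # y # R) (Diag # East # W) m + b * llt q (y # x # R) (Diag # East # W) m =
     (\<Sum>c\<in>Poly_Mapping.keys m. (a * of_bool (x < c) * q ^ of_bool (y < c) + b * of_bool (y < c) * q ^ of_bool (x < c)) * g c)"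
    by (simp add: g_def sum_distrib_left sum.distrib algebra_simps power_add)
  also have "\<dots> = a' * llt q (x # y # R) (East # Diag # W) m + b' * llt q (y # x # R) (East # Diag # W) m"
    unfolding coeff by (simp add: g_def sum_distrib_left sum.distrib algebra_simps)
  finally show ?case using Nil by simp
next
  case (Cons s V)
  have IH: "a * llt q (Q @ x # y # R) (V @ Diag # East # W) m + b * llt q (Q @ y # x # R) (V @ Diag # East # W) m =
    a' * llt q (Q @ x # y # R) (V @ East # Diag # W) m + b' * llt q (Q @ y # x # R) (V @ East # Diag # W) m"
    if "cols V = length Q" for Q R m
    using Cons.IH that by blast
  have step: "a * (\<Sum>c\<in>C. f c * A c) + b * (\<Sum>c\<in>C. f c * B c) = a' * (\<Sum>c\<in>C. f c * A' c) + b' * (\<Sum>c\<in>C. f c * B' c)"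
    if "\<And>c. a * A c + b * B c = a' * A' c + b' * B' c" for C :: "nat set" and f A B A' B'
  proof -
    have "a * (\<Sum>c\<in>C. f c * A c) + b * (\<Sum>c\<in>C. f c * B c) = (\<Sum>c\<in>C. f c * (a * A c + b * B c))"
      by (simp add: sum_distrib_left sum.distrib algebra_simps)
    also have "\<dots> = a' * (\<Sum>c\<in>C. f c * A' c) + b' * (\<Sum>c\<in>C. f c * B' c)"
      unfolding that by (simp add: sum_distrib_left sum.distrib algebra_simps)
    finally show ?thesis .
  qed
  show ?case
  proof (cases s)
    case North
    have eq: "below (Q @ y # x # R) = below (Q @ x # y # R)" by (rule ext) simp
    show ?thesis
      unfolding North append_Cons llt.simps eq
    proof (intro step)
      fix c
      show "a * llt q ((Q @ x # y # R) @ [c]) (V @ Diag # East # W) (m - Poly_Mapping.single c 1) +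
          b * llt q ((Q @ y # x # R) @ [c]) (V @ Diag # East # W) (m - Poly_Mapping.single c 1) =
          a' * llt q ((Q @ x # y # R) @ [c]) (V @ East # Diag # W) (m - Poly_Mapping.single c 1) +
          b' * llt q ((Q @ y # x # R) @ [c]) (V @ East # Diag # W) (m - Poly_Mapping.single c 1)"
        using IH[of Q "R @ [c]" "m - Poly_Mapping.single c 1"] Cons.prems North by simp
    qed
  next
    case East
    then show ?thesis using Cons.prems IH by (cases Q) auto
  next
    case Diag
    then obtain d Q' where Q: "Q = d # Q'" using Cons.prems by (cases Q) auto
    have eq: "below (Q' @ y # x # R) = below (Q' @ x # y # R)" by (rule ext) simp
    show ?thesis
      unfolding Diag Q append_Cons llt.simps eq
    proof (intro step)
      fix c
      show "a * llt q ((Q' @ x # y # R) @ [c]) (V @ Diag # East # W) (m - Poly_Mapping.single c 1) +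
          b * llt q ((Q' @ y # x # R) @ [c]) (V @ Diag # East # W) (m - Poly_Mapping.single c 1) =
          a' * llt q ((Q' @ x # y # R) @ [c]) (V @ East # Diag # W) (m - Poly_Mapping.single c 1) +
          b' * llt q ((Q' @ y # x # R) @ [c]) (V @ East # Diag # W) (m - Poly_Mapping.single c 1)"
        using IH[of Q' "R @ [c]" "m - Poly_Mapping.single c 1"] Cons.prems Diag Q by simp
    qed
  qed
qed

text \<open>The index set, pairs of variables whose product divides \<open>m\<close>, is invariant
  under exchange, so only the symmetrised summand matters.\<close>

lemma sum_ordered_pairs_cong:
  fixes f g :: "nat \<Rightarrow> nat \<Rightarrow> 'k::field"
  assumes "(2::'k) \<noteq> 0" and sym: "\<And>c d. f c d + f d c = g c d + g d c"
  shows "(\<Sum>c\<in>Poly_Mapping.keys m. \<Sum>d\<in>Poly_Mapping.keys (m - Poly_Mapping.single c (1::nat)). f c d) =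
    (\<Sum>c\<in>Poly_Mapping.keys m. \<Sum>d\<in>Poly_Mapping.keys (m - Poly_Mapping.single c 1). g c d)"
proof -
  define T where "T = (SIGMA c:Poly_Mapping.keys m. Poly_Mapping.keys (m - Poly_Mapping.single c (1::nat)))"
  have S: "(\<Sum>c\<in>Poly_Mapping.keys m. \<Sum>d\<in>Poly_Mapping.keys (m - Poly_Mapping.single c (1::nat)). h c d) =
     (\<Sum>(c, d)\<in>T. h c d)" for h :: "nat \<Rightarrow> nat \<Rightarrow> 'k"
    unfolding T_def by (rule sum.Sigma) auto
  have swap: "(\<Sum>(c, d)\<in>T. h c d) = (\<Sum>(c, d)\<in>T. h d c)" for h :: "nat \<Rightarrow> nat \<Rightarrow> 'k"
    by (rule sum.reindex_bij_witness[where i = prod.swap and j = prod.swap])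
      (auto simp: T_def in_keys_iff lookup_minus lookup_single when_def split: if_splits)
  have "2 * (\<Sum>(c, d)\<in>T. h c d) = (\<Sum>(c, d)\<in>T. h c d + h d c)" for h :: "nat \<Rightarrow> nat \<Rightarrow> 'k"
    unfolding mult_2 by (subst (2) swap) (simp add: sum.distrib case_prod_unfold)
  then have "2 * (\<Sum>(c, d)\<in>T. f c d) = 2 * (\<Sum>(c, d)\<in>T. g c d)"
    using sym by simp
  then show ?thesis
    using assms(1) S by simp
qed

text \<open>In the three words the cell of the new row with the oldest row \<open>a\<close> is
  weighted, absent, or a forced ascent, and
  \<open>q ^ of_bool (a < c) = 1 + (q - 1) * of_bool (a < c)\<close>.\<close>

lemma llt_north_east:
  "llt q (a # Q) (North # East # V) m = 1 * llt q (a # Q) (East # North # V) m + (q - 1) * llt q (a # Q) (Diag # V) m"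
  by (simp add: sum_distrib_left algebra_simps of_bool_def flip: sum.distrib)
    (auto intro!: sum.cong simp: algebra_simps)

text \<open>The colourings of the two new rows are paired as \<open>(c, d)\<close> and
  \<open>(d, c)\<close>. The cell formed by these rows supplies the scalars for
  \<open>llt_swap\<close>, which leaves a check on the relative order of three colours.\<close>

lemma llt_nn:
  fixes q :: "'k::field"
  assumes "(2::'k) \<noteq> 0" "cols V = length Q"
  shows "llt q Q (North # North # V @ Diag # East # W) m = q * llt q Q (North # North # V @ East # Diag # W) m"
proof -
  have sw: "q ^ of_bool (x < y) * llt q (Q @ [x, y]) (V @ Diag # East # W) m' +
      q ^ of_bool (y < x) * llt q (Q @ [y, x]) (V @ Diag # East # W) m' =
      q * q ^ of_bool (x < y) * llt q (Q @ [x, y]) (V @ East # Diag # W) m' +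
      q * q ^ of_bool (y < x) * llt q (Q @ [y, x]) (V @ East # Diag # W) m'" for x y m'
    by (rule llt_swap[OF _ assms(2), where R = "[]"]) (auto simp: of_bool_def algebra_simps)
  have "(\<Sum>c\<in>Poly_Mapping.keys m. \<Sum>d\<in>Poly_Mapping.keys (m - Poly_Mapping.single c (1::nat)).
      q ^ (below Q c + below Q d + of_bool (c < d)) *
        llt q (Q @ [c, d]) (V @ Diag # East # W) (m - Poly_Mapping.single c 1 - Poly_Mapping.single d 1)) =
    (\<Sum>c\<in>Poly_Mapping.keys m. \<Sum>d\<in>Poly_Mapping.keys (m - Poly_Mapping.single c (1::nat)).
      q * q ^ (below Q c + below Q d + of_bool (c < d)) *
        llt q (Q @ [c, d]) (V @ East # Diag # W) (m - Poly_Mapping.single c 1 - Poly_Mapping.single d 1))"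
    (is "(\<Sum>c\<in>_. \<Sum>d\<in>_. ?f c d) = (\<Sum>c\<in>_. \<Sum>d\<in>_. ?g c d)")
  proof (rule sum_ordered_pairs_cong[OF assms(1)])
    fix c d
    define m' where "m' = m - Poly_Mapping.single c 1 - Poly_Mapping.single d 1"
    have m': "m - Poly_Mapping.single d 1 - Poly_Mapping.single c 1 = m'"
      by (simp add: m'_def diff_diff_add add.commute)
    have "?f c d + ?f d c = q ^ (below Q c + below Q d) *
      (q ^ of_bool (c < d) * llt q (Q @ [c, d]) (V @ Diag # East # W) m' +
      q ^ of_bool (d < c) * llt q (Q @ [d, c]) (V @ Diag # East # W) m')"
      unfolding m' m'_def[symmetric] by (simp add: power_add algebra_simps)
    also have "\<dots> = ?g c d + ?g d c"
      unfolding sw m' m'_def[symmetric] by (simp add: power_add algebra_simps)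
    finally show "?f c d + ?f d c = ?g c d + ?g d c" .
  qed
  then show ?thesis
    by (simp add: sum_distrib_left power_add algebra_simps)
qed

text \<open>The same pairing. In dn only the first new row meets \<open>y\<close>, in a forced
  ascent; in nd the first has a weighted cell with \<open>y\<close> and the second the forced
  one.\<close>

lemma llt_dn:
  fixes q :: "'k::field"
  assumes "(2::'k) \<noteq> 0" "cols V = length Q"
  shows "llt q (y # Q) (Diag # North # V @ Diag # East # W) m = llt q (y # Q) (North # Diag # V @ East # Diag # W) m"
proof -
  have sw: "of_bool (y < c) * q ^ of_bool (c < d) * llt q (Q @ [c, d]) (V @ Diag # East # W) m' +
      of_bool (y < d) * q ^ of_bool (d < c) * llt q (Q @ [d, c]) (V @ Diag # East # W) m' =
      of_bool (y < d) * q ^ (of_bool (y < c) + of_bool (c < d)) * llt q (Q @ [c, d]) (V @ East # Diag # W) m' +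
      of_bool (y < c) * q ^ (of_bool (y < d) + of_bool (d < c)) * llt q (Q @ [d, c]) (V @ East # Diag # W) m'" for c d m'
    by (rule llt_swap[OF _ assms(2), where R = "[]"]) (auto simp: of_bool_def algebra_simps)
  have "(\<Sum>c\<in>Poly_Mapping.keys m. \<Sum>d\<in>Poly_Mapping.keys (m - Poly_Mapping.single c (1::nat)).
      of_bool (y < c) * q ^ (below Q c + below Q d + of_bool (c < d)) *
        llt q (Q @ [c, d]) (V @ Diag # East # W) (m - Poly_Mapping.single c 1 - Poly_Mapping.single d 1)) =
    (\<Sum>c\<in>Poly_Mapping.keys m. \<Sum>d\<in>Poly_Mapping.keys (m - Poly_Mapping.single c (1::nat)).
      of_bool (y < d) * q ^ (below Q c + below Q d + (of_bool (y < c) + of_bool (c < d))) *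
        llt q (Q @ [c, d]) (V @ East # Diag # W) (m - Poly_Mapping.single c 1 - Poly_Mapping.single d 1))"
    (is "(\<Sum>c\<in>_. \<Sum>d\<in>_. ?f c d) = (\<Sum>c\<in>_. \<Sum>d\<in>_. ?g c d)")
  proof (rule sum_ordered_pairs_cong[OF assms(1)])
    fix c d
    define m' where "m' = m - Poly_Mapping.single c 1 - Poly_Mapping.single d 1"
    have m': "m - Poly_Mapping.single d 1 - Poly_Mapping.single c 1 = m'"
      by (simp add: m'_def diff_diff_add add.commute)
    have "?f c d + ?f d c = q ^ (below Q c + below Q d) *
      (of_bool (y < c) * q ^ of_bool (c < d) * llt q (Q @ [c, d]) (V @ Diag # East # W) m' +
      of_bool (y < d) * q ^ of_bool (d < c) * llt q (Q @ [d, c]) (V @ Diag # East # W) m')"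
      unfolding m' m'_def[symmetric] by (simp add: power_add algebra_simps)
    also have "\<dots> = ?g c d + ?g d c"
      unfolding sw m' m'_def[symmetric] by (simp add: power_add algebra_simps)
    finally show "?f c d + ?f d c = ?g c d + ?g d c" .
  qed
  then show ?thesis
    by (simp add: sum_distrib_left power_add algebra_simps)
qed

section \<open>Concatenation and products\<close>

text \<open>Removing a variable and splitting the rest is the same as splitting first and removing
  the variable from the left factor. This carries the recursion of \<open>llt\<close> through the
  convolution product.\<close>

lemma sum_splits_step:
  fixes g :: "nat \<Rightarrow> monomial \<Rightarrow> 'k::comm_ring_1"
  shows "(\<Sum>c\<in>Poly_Mapping.keys m. \<Sum>(a, b)\<in>splits (m - Poly_Mapping.single c 1). g c a * h b) =
    (\<Sum>(a, b)\<in>splits m. (\<Sum>c\<in>Poly_Mapping.keys a. g c (a - Poly_Mapping.single c 1)) * h b)"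
proof -
  have add: "(a - Poly_Mapping.single c 1) + Poly_Mapping.single c 1 = a" if "c \<in> Poly_Mapping.keys a"
    for a :: monomial and c
    by (rule poly_mapping_eqI) (use that in \<open>auto simp: lookup_add lookup_minus lookup_single when_def in_keys_iff\<close>)
  have "(\<Sum>c\<in>Poly_Mapping.keys m. \<Sum>(a, b)\<in>splits (m - Poly_Mapping.single c 1). g c a * h b) =
      (\<Sum>(c, p)\<in>(SIGMA c:Poly_Mapping.keys m. splits (m - Poly_Mapping.single c 1)). g c (fst p) * h (snd p))"
    by (simp add: sum.Sigma case_prod_unfold)
  also have "\<dots> = (\<Sum>(p, c)\<in>(SIGMA p:splits m. Poly_Mapping.keys (fst p)). g c (fst p - Poly_Mapping.single c 1) * h (snd p))"
  proof (rule sum.reindex_bij_witness[where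
        j = "\<lambda>(c, p). ((fst p + Poly_Mapping.single c 1, snd p), c)" and
        i = "\<lambda>(p, c). (c, (fst p - Poly_Mapping.single c 1, snd p))"], goal_cases)
    case (2 x)
    then obtain c a b where x: "x = (c, (a, b))" "c \<in> Poly_Mapping.keys m" "a + b = m - Poly_Mapping.single c 1"
      by (auto simp: splits_def)
    have "a + Poly_Mapping.single c 1 + b = a + b + Poly_Mapping.single c 1"
      by (simp only: ac_simps)
    also have "\<dots> = m" unfolding x(3) by (rule add[OF x(2)])
    finally have "a + Poly_Mapping.single c 1 + b = m" .
    then show ?case
      using x by (auto simp: splits_def in_keys_iff lookup_add)
  next
    case (4 x)
    then obtain c a b where x: "x = ((a, b), c)" "c \<in> Poly_Mapping.keys a" "a + b = m"
      by (auto simp: splits_def)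
    have "m = (a - Poly_Mapping.single c 1 + Poly_Mapping.single c 1) + b"
      using x(3) unfolding add[OF x(2)] by simp
    also have "\<dots> = (a - Poly_Mapping.single c 1 + b) + Poly_Mapping.single c 1"
      by (simp only: ac_simps)
    finally have "a - Poly_Mapping.single c 1 + b = m - Poly_Mapping.single c 1"
      by (metis add_diff_cancel_right')
    then show ?case
      using x by (auto simp: splits_def in_keys_iff lookup_add)
  next
    case (3 x)
    then show ?case using add by (auto simp: splits_def)
  qed (auto simp: splits_def)
  also have "\<dots> = (\<Sum>p\<in>splits m. \<Sum>c\<in>Poly_Mapping.keys (fst p). g c (fst p - Poly_Mapping.single c 1) * h (snd p))"
    by (simp add: sum.Sigma)
  finally show ?thesis
    by (simp add: case_prod_unfold sum_distrib_right)
qed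

text \<open>A word that ends with surplus 0 empties the list, so \<open>R\<close> starts
  afresh.\<close>

lemma llt_append:
  assumes "surplus (length Q) P = Some 0"
  shows "llt q Q (P @ R) m = (\<Sum>(a, b)\<in>splits m. llt q Q P a * llt q [] R b)"
  using assms
proof (induction q Q P m rule: llt.induct)
  case (1 q Q m)
  then have "(\<Sum>(a, b)\<in>splits m. llt q Q [] a * llt q [] R b) = (\<Sum>(a, b)\<in>{(0::monomial, m)}. llt q Q [] a * llt q [] R b)"
    by (intro sum.mono_neutral_right finite_splits) (auto simp: splits_def)
  then show ?case using 1 by simp
next
  case (2 q Q w m)
  then have "llt q Q ((North # w) @ R) m = (\<Sum>c\<in>Poly_Mapping.keys m. \<Sum>(a, b)\<in>splits (m - Poly_Mapping.single c 1).
      (q ^ below Q c * llt q (Q @ [c]) w a) * llt q [] R b)"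
    by (simp add: sum_distrib_left case_prod_unfold mult.assoc)
  then show ?case unfolding sum_splits_step by simp
next
  case (6 q a Q w m)
  then have "llt q (a # Q) ((Diag # w) @ R) m = (\<Sum>c\<in>Poly_Mapping.keys m. \<Sum>(x, b)\<in>splits (m - Poly_Mapping.single c 1).
      (of_bool (a < c) * q ^ below Q c * llt q (Q @ [c]) w x) * llt q [] R b)"
    by (simp add: sum_distrib_left case_prod_unfold mult.assoc)
  then show ?case unfolding sum_splits_step by simp
qed auto

section \<open>Hooks and elementary symmetric functions\<close>

definition sqfree :: "nat \<Rightarrow> monomial \<Rightarrow> bool" where
  "sqfree k m \<longleftrightarrow> card (Poly_Mapping.keys m) = k \<and> (\<forall>i. Poly_Mapping.lookup m i \<le> 1)"

lemma sqfree_remove_min: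
  assumes "c \<in> Poly_Mapping.keys m"
  shows "sqfree k (m - Poly_Mapping.single c 1) \<and> (\<forall>i\<in>Poly_Mapping.keys (m - Poly_Mapping.single c 1). c < i) \<longleftrightarrow>
    sqfree (Suc k) m \<and> c = Min (Poly_Mapping.keys m)"
proof
  let ?m = "m - Poly_Mapping.single c 1"
  have ks: "Poly_Mapping.keys ?m = Poly_Mapping.keys m - {c}" if "Poly_Mapping.lookup m c \<le> 1"
    using that by (auto simp: in_keys_iff lookup_minus lookup_single when_def split: if_splits)
  { assume L: "sqfree k ?m \<and> (\<forall>i\<in>Poly_Mapping.keys ?m. c < i)"
    have c1: "Poly_Mapping.lookup m c \<le> 1"
      using L by (force simp: in_keys_iff lookup_minus lookup_single)
    have "Poly_Mapping.lookup m i \<le> 1" for i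
      using L c1 by (cases "i = c") (auto simp: sqfree_def lookup_minus lookup_single when_def dest: spec[of _ i])
    moreover have "card (Poly_Mapping.keys m) = Suc k"
      using L ks[OF c1] assms card_Suc_Diff1[of "Poly_Mapping.keys m" c] by (auto simp: sqfree_def)
    moreover have "c = Min (Poly_Mapping.keys m)"
    proof (rule Min_eqI[symmetric])
      fix i assume "i \<in> Poly_Mapping.keys m"
      then show "c \<le> i"
        using L ks[OF c1] by (cases "i = c") (auto intro: less_imp_le)
    qed (use assms in auto)
    ultimately show "sqfree (Suc k) m \<and> c = Min (Poly_Mapping.keys m)"
      by (simp add: sqfree_def) }
  { assume R: "sqfree (Suc k) m \<and> c = Min (Poly_Mapping.keys m)"
    then have c1: "Poly_Mapping.lookup m c \<le> 1" by (auto simp: sqfree_def)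
    have "c < i" if "i \<in> Poly_Mapping.keys m - {c}" for i
      using R that by (metis DiffE Min_le finite_keys le_neq_implies_less singletonI)
    then show "sqfree k ?m \<and> (\<forall>i\<in>Poly_Mapping.keys ?m. c < i)"
      using R ks[OF c1] assms
      by (auto simp: sqfree_def lookup_minus lookup_single when_def intro: le_trans[OF diff_le_self]) }
qed

text \<open>Along a hook the colours increase strictly, so only the least one can come first and
  each squarefree monomial arises once. The upward closed \<open>A\<close> covers the first row,
  which is free, and later ones, which must exceed the preceding colour.\<close>

lemma sum_sqfree:
  assumes "\<And>c d. A c \<Longrightarrow> c \<le> d \<Longrightarrow> A d"
  shows "(\<Sum>c\<in>Poly_Mapping.keys m. of_bool (A c) * of_bool (sqfree k (m - Poly_Mapping.single c 1) \<and>
      (\<forall>i\<in>Poly_Mapping.keys (m - Poly_Mapping.single c 1). c < i))) =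
    (of_bool (sqfree (Suc k) m \<and> (\<forall>i\<in>Poly_Mapping.keys m. A i)) :: 'k::comm_ring_1)"
proof -
  have "(\<Sum>c\<in>Poly_Mapping.keys m. of_bool (A c) * of_bool (sqfree k (m - Poly_Mapping.single c 1) \<and>
      (\<forall>i\<in>Poly_Mapping.keys (m - Poly_Mapping.single c 1). c < i))) =
    (\<Sum>c\<in>Poly_Mapping.keys m. if c = Min (Poly_Mapping.keys m) then of_bool (sqfree (Suc k) m \<and> A c) else (0::'k))"
    by (intro sum.cong refl, subst sqfree_remove_min) auto
  also have "\<dots> = of_bool (sqfree (Suc k) m \<and> Min (Poly_Mapping.keys m) \<in> Poly_Mapping.keys m \<and> A (Min (Poly_Mapping.keys m)))"
    by (simp add: sum.delta)
  also have "(sqfree (Suc k) m \<and> Min (Poly_Mapping.keys m) \<in> Poly_Mapping.keys m \<and> A (Min (Poly_Mapping.keys m))) \<longleftrightarrow>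
      sqfree (Suc k) m \<and> (\<forall>i\<in>Poly_Mapping.keys m. A i)"
  proof (cases "Poly_Mapping.keys m = {}")
    case False
    then have "Min (Poly_Mapping.keys m) \<in> Poly_Mapping.keys m" by simp
    then show ?thesis using assms[OF _ Min_le[OF finite_keys]] by blast
  qed (simp add: sqfree_def)
  finally show ?thesis .
qed

lemma llt_diags_east:
  "llt q [a] (replicate k Diag @ [East]) m = of_bool (sqfree k m \<and> (\<forall>i\<in>Poly_Mapping.keys m. a < i))"
proof (induction k arbitrary: a m)
  case 0
  show ?case by (auto simp: sqfree_def)
next
  case (Suc k)
  then show ?case by (simp add: sum_sqfree[of "\<lambda>c. a < c", unfolded One_nat_def])
qed

lemma llt_hook: "llt q [] (North # replicate k Diag @ [East]) = coefficient (elem_sym (Suc k))"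
proof
  fix m
  show "llt q [] (North # replicate k Diag @ [East]) m = coefficient (elem_sym (Suc k)) m"
    using sum_sqfree[of "\<lambda>_. True" k m, where 'k = 'a]
    by (simp add: llt_diags_east elem_sym.rep_eq) (simp add: sqfree_def)
qed

section \<open>Relations (iii) and (iv) for the LLT polynomials\<close>

lemma llt_bounce_nn:
  fixes q :: "'k::field"
  assumes "(2::'k) \<noteq> 0" "surplus 0 (U @ North # North # V) = Some k" "rows U = cols (U @ North # North # V)"
  shows "llt q [] (U @ North # North # V @ Diag # East # W) m =
    q * llt q [] (U @ North # North # V @ East # Diag # W) m"
proof -
  obtain h where h: "surplus 0 U = Some h"
    using assms(2) by (auto simp: bind_eq_Some_conv)
  \<comment> \<open>The counting condition says that exactly \<open>cols V\<close> rows are pending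
    after \<open>U\<close>, as \<open>llt_nn\<close> asks of the list.\<close>
  have "h = cols V"
    using surplus_rows_cols[OF h] assms(3) by simp
  then show ?thesis
    using llt_prefix[of "[]" U h q "North # North # V @ Diag # East # W" q "North # North # V @ East # Diag # W" 0 "[]" m]
      llt_nn[OF assms(1), of V _ q W] h by simp
qed

lemma llt_bounce_dn:
  fixes q :: "'k::field"
  assumes "(2::'k) \<noteq> 0" "surplus 0 (U @ Diag # North # V) = Some k" "rows U = cols (U @ Diag # North # V)"
  shows "llt q [] (U @ Diag # North # V @ Diag # East # W) m =
    llt q [] (U @ North # Diag # V @ East # Diag # W) m"
proof -
  obtain h where h: "surplus 0 U = Some h"
    using assms(2) by (auto simp: bind_eq_Some_conv)
  \<comment> \<open>One row more, since the displayed diagonal step passes a row too.\<close>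
  have "h = Suc (cols V)"
    using surplus_rows_cols[OF h] assms(3) by simp
  moreover have "llt q R (Diag # North # V @ Diag # East # W) m =
      1 * llt q R (North # Diag # V @ East # Diag # W) m + 0 * llt q R [] m"
    if "length R = Suc (cols V)" for R m
    using that llt_dn[OF assms(1), of V "tl R" q "hd R" W m] by (cases R) auto
  ultimately show ?thesis
    using llt_prefix[of "[]" U h q "Diag # North # V @ Diag # East # W" 1 "North # Diag # V @ East # Diag # W" 0 "[]" m]
      h by simp
qed

lemma llt_unicellular:
  assumes "U @ Diag # V \<in> SCH"
  shows "llt q [] (U @ North # East # V) m =
    llt q [] (U @ East # North # V) m + (q - 1) * llt q [] (U @ Diag # V) m"
proof -
  obtain h where h: "surplus 0 U = Some (Suc h)"
  proof (cases "surplus 0 U")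
    case (Some h)
    then show ?thesis using that assms by (cases h) (auto simp: SCH_iff)
  qed (use assms in \<open>auto simp: SCH_iff\<close>)
  have "llt q R (North # East # V) m = 1 * llt q R (East # North # V) m + (q - 1) * llt q R (Diag # V) m"
    if "length R = Suc h" for R m
    using that llt_north_east[of q "hd R" "tl R" V m] by (cases R) auto
  then show ?thesis
    using llt_prefix[of "[]" U "Suc h" q "North # East # V" 1 "East # North # V" "q - 1" "Diag # V" m] h by simp
qed

text \<open>The recursion compares colours by their order, so symmetry is not visible from it. By
  (iii) and (iv) the series are generated from hooks by linear combinations and products, which stay
  symmetric.\<close>

lemma llt_in_range_coefficient:
  fixes q :: "'k::field"
  assumes "q \<noteq> 1" "(2::'k) \<noteq> 0" "P \<in> SCH"
  shows "llt q [] P \<in> range coefficient"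
proof -
  interpret bounce_relations "\<lambda>c f m. c * f m" q "llt q []"
  proof
    fix a b :: 'k and x y :: "monomial \<Rightarrow> 'k"
    show "(\<lambda>m. a * (x + y) m) = (\<lambda>m. a * x m) + (\<lambda>m. a * y m)"
      by (rule ext) (simp add: distrib_left)
    show "(\<lambda>m. (a + b) * x m) = (\<lambda>m. a * x m) + (\<lambda>m. b * x m)"
      by (rule ext) (simp add: distrib_right)
  next
    fix U V
    assume "U @ Diag # V \<in> SCH"
    then show "llt q [] (U @ North # East # V) - llt q [] (U @ East # North # V) =
        (\<lambda>m. (q - 1) * llt q [] (U @ Diag # V) m)"
      by (intro ext) (simp add: llt_unicellular)
  qed (use assms in \<open>auto simp: llt_bounce_nn llt_bounce_dn mult.assoc intro!: ext\<close>)
  show ?thesis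
  proof (rule F_in_subspace[OF _ _ _ _ assms(3)])
    have "(\<lambda>m. 0) = coefficient (0 :: 'k symfun)"
      "(\<lambda>m. coefficient f m + coefficient g m) = coefficient (f + g)"
      "(\<lambda>m. c * coefficient f m) = coefficient (symfun_scale c f)" for f g :: "'k symfun" and c
      by (simp_all add: zero_symfun.rep_eq plus_symfun.rep_eq symfun_scale.rep_eq)
    then show "subspace (range coefficient)"
      by (auto simp: subspace_def zero_fun_def plus_fun_def)
    have "llt q [] [] = coefficient 1"
      by (rule ext) (simp add: one_symfun.rep_eq)
    then show "llt q [] [] \<in> range coefficient" by simp
    fix k
    show "llt q [] (North # replicate k Diag @ [East]) \<in> range coefficient"
      unfolding llt_hook by simp
  next
    fix P Q
    assume "P \<in> SCH" "llt q [] P \<in> range coefficient" "llt q [] Q \<in> range coefficient"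
    then obtain f g where "llt q [] P = coefficient f" "llt q [] Q = coefficient g" by blast
    then have "llt q [] (P @ Q) = coefficient (f * g)"
      using \<open>P \<in> SCH\<close> by (intro ext) (simp add: llt_append SCH_iff times_symfun.rep_eq)
    then show "llt q [] (P @ Q) \<in> range coefficient" by simp
  qed
qed

definition llt_symfun :: "'k::field \<Rightarrow> path \<Rightarrow> 'k symfun" where
  "llt_symfun q P = Abs_symfun (llt q [] P)"

lemma coefficient_llt_symfun:
  fixes q :: "'k::field"
  assumes "q \<noteq> 1" "(2::'k) \<noteq> 0" "P \<in> SCH"
  shows "coefficient (llt_symfun q P) = llt q [] P"
  using llt_in_range_coefficient[OF assms] by (auto simp: llt_symfun_def coefficient_inverse)

section \<open>Existence and uniqueness\<close>

definition bounce_condition :: "('k \<Rightarrow> 'a \<Rightarrow> 'a) \<Rightarrow> 'k \<Rightarrow> (path \<Rightarrow> 'a) \<Rightarrow> bool" where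
  "bounce_condition scale q F \<longleftrightarrow>
    (\<forall>P\<in>SCH. \<forall>x z bs r U s t V W.
       on_path P (x, z) \<and> x + 1 < z \<and>
       bounce_path P (x, z) bs r \<and> length bs = 1 \<and>
       bounce_decomposition P (x, z) U s t V Diag East W \<longrightarrow>
       ([s, t] = [North, North] \<longrightarrow>
          F P = scale q (F (U @ [North, North] @ V @ [East, Diag] @ W))) \<and>
       ([s, t] = [Diag, North] \<longrightarrow>
          F P = F (U @ [North, Diag] @ V @ [East, Diag] @ W)))"

text \<open>Trades the geometric form of (iv) for counts: \<open>single_bounceI\<close> produces a
  point with one bounce point, and \<open>single_bounce_counts\<close> recovers the counts.\<close>

lemma bounce_condition_iff:
  "bounce_condition scale q F \<longleftrightarrow>
    (\<forall>U V W k. surplus 0 (U @ North # North # V) = Some k \<and> 2 \<le> k \<and>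
      rows U = cols (U @ North # North # V) \<and> U @ North # North # V @ Diag # East # W \<in> SCH \<longrightarrow>
      F (U @ North # North # V @ Diag # East # W) = scale q (F (U @ North # North # V @ East # Diag # W))) \<and>
    (\<forall>U V W k. surplus 0 (U @ Diag # North # V) = Some k \<and> 2 \<le> k \<and>
      rows U = cols (U @ Diag # North # V) \<and> U @ Diag # North # V @ Diag # East # W \<in> SCH \<longrightarrow>
      F (U @ Diag # North # V @ Diag # East # W) = F (U @ North # Diag # V @ East # Diag # W))"
    (is "?L \<longleftrightarrow> ?N \<and> ?D")
proof (intro iffI conjI)
  assume L: ?L
  show ?N
  proof (intro allI impI, elim conjE)
    fix U V W k
    let ?P = "U @ North # North # V @ Diag # East # W"
    assume a: "surplus 0 (U @ North # North # V) = Some k" "2 \<le> k"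
      "rows U = cols (U @ North # North # V)" "?P \<in> SCH"
    obtain x z where "on_path ?P (x, z)" "x + 1 < z" "bounce_path ?P (x, z) [(x, x)] (path_end (U @ [North]))"
        "bounce_decomposition ?P (x, z) U North North V Diag East W"
      by (rule single_bounceI[OF a(1-3) _ refl]) auto
    then have "on_path ?P (x, z) \<and> x + 1 < z \<and> bounce_path ?P (x, z) [(x, x)] (path_end (U @ [North])) \<and>
        length [(x, x)] = 1 \<and> bounce_decomposition ?P (x, z) U North North V Diag East W" by simp
    from L[unfolded bounce_condition_def, rule_format, OF a(4) this]
    show "F ?P = scale q (F (U @ North # North # V @ East # Diag # W))" by simp
  qed
  show ?D
  proof (intro allI impI, elim conjE)
    fix U V W k
    let ?P = "U @ Diag # North # V @ Diag # East # W"
    assume a: "surplus 0 (U @ Diag # North # V) = Some k" "2 \<le> k"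
      "rows U = cols (U @ Diag # North # V)" "?P \<in> SCH"
    obtain x z where "on_path ?P (x, z)" "x + 1 < z" "bounce_path ?P (x, z) [(x, x)] (path_end (U @ [Diag]))"
        "bounce_decomposition ?P (x, z) U Diag North V Diag East W"
      by (rule single_bounceI[OF a(1-3) _ refl]) auto
    then have "on_path ?P (x, z) \<and> x + 1 < z \<and> bounce_path ?P (x, z) [(x, x)] (path_end (U @ [Diag])) \<and>
        length [(x, x)] = 1 \<and> bounce_decomposition ?P (x, z) U Diag North V Diag East W" by simp
    from L[unfolded bounce_condition_def, rule_format, OF a(4) this]
    show "F ?P = F (U @ North # Diag # V @ East # Diag # W)" by simp
  qed
next
  assume R: "?N \<and> ?D"
  show ?L
    unfolding bounce_condition_def
  proof (intro ballI allI impI, elim conjE)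
    fix P x z bs r U s t V W
    assume P: "P \<in> SCH" and b: "x + 1 < z" "bounce_path P (x, z) bs r" "length bs = 1"
      and d: "bounce_decomposition P (x, z) U s t V Diag East W"
    have P': "P = U @ s # t # V @ Diag # East # W"
      using d by (simp add: bounce_decomposition_def)
    show "([s, t] = [North, North] \<longrightarrow> F P = scale q (F (U @ [North, North] @ V @ [East, Diag] @ W))) \<and>
       ([s, t] = [Diag, North] \<longrightarrow> F P = F (U @ [North, Diag] @ V @ [East, Diag] @ W))"
    proof (intro conjI impI)
      assume st: "[s, t] = [North, North]"
      then have d': "bounce_decomposition P (x, z) U North North V Diag East W" using d by simp
      obtain k where "surplus 0 (U @ North # North # V) = Some k" "2 \<le> k" "rows U = cols (U @ North # North # V)"
        by (rule single_bounce_counts[OF b(2,3,1) d' _ P]) auto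
      then show "F P = scale q (F (U @ [North, North] @ V @ [East, Diag] @ W))"
        using R P st unfolding P' by auto
    next
      assume st: "[s, t] = [Diag, North]"
      then have d': "bounce_decomposition P (x, z) U Diag North V Diag East W" using d by simp
      obtain k where "surplus 0 (U @ Diag # North # V) = Some k" "2 \<le> k" "rows U = cols (U @ Diag # North # V)"
        by (rule single_bounce_counts[OF b(2,3,1) d' _ P]) auto
      then show "F P = F (U @ [North, Diag] @ V @ [East, Diag] @ W)"
        using R P st unfolding P' by auto
    qed
  qed
qed

text \<open>Surplus at least 2 keeps the path above the diagonal after the east step, so the
  diagonal step remains legal.\<close>

lemma SCH_slide:
  assumes "surplus 0 A = Some k" "surplus 0 B = Some k" "2 \<le> k" "A @ Diag # East # W \<in> SCH"
  shows "B @ East # Diag # W \<in> SCH"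
proof -
  obtain l where "k = Suc (Suc l)" using assms(3) by (metis add_2_eq_Suc le_Suc_ex)
  then show ?thesis using assms by (simp add: SCH_iff)
qed

lemma two_neq_zero_ratfun: "(2 :: ratfun) \<noteq> 0"
proof -
  have "(2 :: ratfun) = Fraction_Field.Fract 2 1"
    by (metis One_fract_def add_fract div_by_1 mult_1 one_add_one zero_neq_one mult_1_right)
  then show ?thesis
    unfolding Zero_fract_def by (simp only: eq_fract)
qed

lemma q_indet_neq_1: "q_indet \<noteq> 1"
  by (simp add: q_indet_def One_fract_def eq_fract one_pCons)

theorem theorem2p1:
  fixes scaleA :: "ratfun \<Rightarrow> 'a::ring_1 \<Rightarrow> 'a"
    and \<iota> :: "ratfun symfun \<Rightarrow> 'a"
  assumes "unital_algebra scaleA"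
    and "symfun_embedding scaleA \<iota>"
  shows "\<exists>!F. F \<in> SCH \<rightarrow>\<^sub>E (UNIV :: 'a set) \<and>
    (\<forall>k. F ([North] @ replicate k Diag @ [East]) = \<iota> (elem_sym (k + 1))) \<and>
    multiplicative F \<and>
    (\<forall>U V. U @ [Diag] @ V \<in> SCH \<longrightarrow>
       F (U @ [North, East] @ V) - F (U @ [East, North] @ V)
         = scaleA (q_indet - 1) (F (U @ [Diag] @ V))) \<and>
    (\<forall>P\<in>SCH. \<forall>x z bs r U s t V W.
       on_path P (x, z) \<and> x + 1 < z \<and>
       bounce_path P (x, z) bs r \<and> length bs = 1 \<and>
       bounce_decomposition P (x, z) U s t V Diag East W \<longrightarrow>
       ([s, t] = [North, North] \<longrightarrow>
          F P = scaleA q_indet (F (U @ [North, North] @ V @ [East, Diag] @ W))) \<and>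
       ([s, t] = [Diag, North] \<longrightarrow>
          F P = F (U @ [North, Diag] @ V @ [East, Diag] @ W)))"
  unfolding bounce_condition_def[symmetric]
proof (rule ex_ex1I)
  note iota = assms(2)[unfolded symfun_embedding_def]
  have iota_minus: "\<iota> f - \<iota> g = \<iota> (f - g)" for f g
    using iota by (metis add_diff_cancel diff_add_cancel)
  note coeff = coefficient_llt_symfun[OF q_indet_neq_1 two_neq_zero_ratfun]
  define f where "f = llt_symfun q_indet"
  \<comment> \<open>Outside \<open>SCH\<close> the value is fixed as \<open>undefined\<close>, so
    that uniqueness makes sense for total functions.\<close>
  define F where "F = restrict (\<lambda>P. \<iota> (f P)) SCH"
  note f = coeff[folded f_def]
  have F: "F P = \<iota> (f P)" if "P \<in> SCH" for P
    using that by (simp add: F_def)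
  have "F ([North] @ replicate k Diag @ [East]) = \<iota> (elem_sym (k + 1))" for k
  proof -
    have S: "North # replicate k Diag @ [East] \<in> SCH"
    proof -
      have "surplus (Suc 0) (replicate k Diag) = Some (Suc 0)" by (induction k) auto
      then show ?thesis by (simp add: SCH_iff)
    qed
    have "f (North # replicate k Diag @ [East]) = elem_sym (k + 1)"
      unfolding coefficient_inject[symmetric] f[OF S] llt_hook by simp
    then show ?thesis using F[OF S] by simp
  qed
  moreover have "multiplicative F"
    unfolding multiplicative_def
  proof (intro conjI ballI)
    have S: "[] \<in> SCH" by (simp add: SCH_iff)
    have "f [] = 1"
      unfolding coefficient_inject[symmetric] f[OF S] by (rule ext) (simp add: one_symfun.rep_eq)
    then show "F [] = 1" using F[OF S] iota by simp
    fix P Q assume S: "P \<in> SCH" "Q \<in> SCH"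
    have "f (P @ Q) = f P * f Q"
      unfolding coefficient_inject[symmetric] times_symfun.rep_eq f[OF S(1)] f[OF S(2)] f[OF SCH_append[OF S]]
      using S by (intro ext) (simp add: llt_append SCH_iff)
    then show "F (P @ Q) = F P * F Q"
      using F S SCH_append[OF S] iota by simp
  qed
  moreover have "F (U @ [North, East] @ V) - F (U @ [East, North] @ V)
         = scaleA (q_indet - 1) (F (U @ [Diag] @ V))" if "U @ [Diag] @ V \<in> SCH" for U V
  proof -
    have S: "U @ Diag # V \<in> SCH" "U @ North # East # V \<in> SCH" "U @ East # North # V \<in> SCH"
    proof -
      show "U @ Diag # V \<in> SCH" using that by simp
      then obtain h where "surplus 0 U = Some (Suc h)" "surplus (Suc h) V = Some 0"
        by (cases "surplus 0 U"; cases "the (surplus 0 U)") (auto simp: SCH_iff)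
      then show "U @ North # East # V \<in> SCH" "U @ East # North # V \<in> SCH"
        by (simp_all add: SCH_iff)
    qed
    have "f (U @ North # East # V) - f (U @ East # North # V) = symfun_scale (q_indet - 1) (f (U @ Diag # V))"
      unfolding coefficient_inject[symmetric] minus_symfun_def plus_symfun.rep_eq uminus_symfun.rep_eq
        symfun_scale.rep_eq f[OF S(1)] f[OF S(2)] f[OF S(3)]
      by (intro ext) (simp add: llt_unicellular[OF S(1)])
    then show ?thesis
      using F S iota by (simp add: iota_minus)
  qed
  moreover have "bounce_condition scaleA q_indet F"
    unfolding bounce_condition_iff
  proof (intro conjI allI impI; elim conjE)
    fix U V W k
    assume a: "surplus 0 (U @ North # North # V) = Some k" "2 \<le> k"
      "rows U = cols (U @ North # North # V)" and S: "U @ North # North # V @ Diag # East # W \<in> SCH"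
    have S': "U @ North # North # V @ East # Diag # W \<in> SCH"
      using SCH_slide[OF a(1,1,2)] S by simp
    have "f (U @ North # North # V @ Diag # East # W) = symfun_scale q_indet (f (U @ North # North # V @ East # Diag # W))"
      unfolding coefficient_inject[symmetric] symfun_scale.rep_eq f[OF S] f[OF S']
      by (intro ext llt_bounce_nn[OF two_neq_zero_ratfun a(1,3)])
    then show "F (U @ North # North # V @ Diag # East # W) = scaleA q_indet (F (U @ North # North # V @ East # Diag # W))"
      using F S S' iota by simp
  next
    fix U V W k
    assume a: "surplus 0 (U @ Diag # North # V) = Some k" "2 \<le> k"
      "rows U = cols (U @ Diag # North # V)" and S: "U @ Diag # North # V @ Diag # East # W \<in> SCH"
    have S': "U @ North # Diag # V @ East # Diag # W \<in> SCH"
    proof -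
      have "surplus 0 (U @ North # Diag # V) = Some k"
      proof (cases "surplus 0 U")
        case (Some h)
        then show ?thesis using a(1) by (cases h) auto
      qed (use a(1) in auto)
      then show ?thesis
        using SCH_slide[OF a(1) _ a(2), of "U @ North # Diag # V" W] S by simp
    qed
    have "f (U @ Diag # North # V @ Diag # East # W) = f (U @ North # Diag # V @ East # Diag # W)"
      unfolding coefficient_inject[symmetric] f[OF S] f[OF S']
      by (intro ext llt_bounce_dn[OF two_neq_zero_ratfun a(1,3)])
    then show "F (U @ Diag # North # V @ Diag # East # W) = F (U @ North # Diag # V @ East # Diag # W)"
      using F S S' by simp
  qed
  ultimately show "\<exists>F. F \<in> SCH \<rightarrow>\<^sub>E (UNIV :: 'a set) \<and>
    (\<forall>k. F ([North] @ replicate k Diag @ [East]) = \<iota> (elem_sym (k + 1))) \<and>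
    multiplicative F \<and>
    (\<forall>U V. U @ [Diag] @ V \<in> SCH \<longrightarrow>
       F (U @ [North, East] @ V) - F (U @ [East, North] @ V)
         = scaleA (q_indet - 1) (F (U @ [Diag] @ V))) \<and>
    bounce_condition scaleA q_indet F"
    by (intro exI[of _ F]) (auto simp: F_def)
next
  interpret unital_algebra scaleA by (rule assms(1))
  fix F G
  assume F: "F \<in> SCH \<rightarrow>\<^sub>E (UNIV :: 'a set) \<and>
    (\<forall>k. F ([North] @ replicate k Diag @ [East]) = \<iota> (elem_sym (k + 1))) \<and>
    multiplicative F \<and>
    (\<forall>U V. U @ [Diag] @ V \<in> SCH \<longrightarrow>
       F (U @ [North, East] @ V) - F (U @ [East, North] @ V)
         = scaleA (q_indet - 1) (F (U @ [Diag] @ V))) \<and>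
    bounce_condition scaleA q_indet F"
  assume G: "G \<in> SCH \<rightarrow>\<^sub>E (UNIV :: 'a set) \<and>
    (\<forall>k. G ([North] @ replicate k Diag @ [East]) = \<iota> (elem_sym (k + 1))) \<and>
    multiplicative G \<and>
    (\<forall>U V. U @ [Diag] @ V \<in> SCH \<longrightarrow>
       G (U @ [North, East] @ V) - G (U @ [East, North] @ V)
         = scaleA (q_indet - 1) (G (U @ [Diag] @ V))) \<and>
    bounce_condition scaleA q_indet G"
  \<comment> \<open>Conditions (iii) and (iv) are linear, so they pass to the difference of two
    solutions.\<close>
  interpret bounce_relations scaleA q_indet "\<lambda>P. F P - G P"
  proof
    fix U V
    assume "U @ Diag # V \<in> SCH"
    then have eq: "F (U @ North # East # V) - F (U @ East # North # V) = scaleA (q_indet - 1) (F (U @ Diag # V))"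
      "G (U @ North # East # V) - G (U @ East # North # V) = scaleA (q_indet - 1) (G (U @ Diag # V))"
      using F G by simp_all
    then show "F (U @ North # East # V) - G (U @ North # East # V) - (F (U @ East # North # V) - G (U @ East # North # V)) =
        scaleA (q_indet - 1) (F (U @ Diag # V) - G (U @ Diag # V))"
      unfolding scale_right_diff_distrib eq[symmetric] by (simp add: algebra_simps)
  next
    fix U V W k
    assume "surplus 0 (U @ North # North # V) = Some k" "2 \<le> k"
      "rows U = cols (U @ North # North # V)" "U @ North # North # V @ Diag # East # W \<in> SCH"
    then show "F (U @ North # North # V @ Diag # East # W) - G (U @ North # North # V @ Diag # East # W) =
        scaleA q_indet (F (U @ North # North # V @ East # Diag # W) - G (U @ North # North # V @ East # Diag # W))"
      using F G unfolding bounce_condition_iff scale_right_diff_distrib by metis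
  next
    fix U V W k
    assume "surplus 0 (U @ Diag # North # V) = Some k" "2 \<le> k"
      "rows U = cols (U @ Diag # North # V)" "U @ Diag # North # V @ Diag # East # W \<in> SCH"
    then show "F (U @ Diag # North # V @ Diag # East # W) - G (U @ Diag # North # V @ Diag # East # W) =
        F (U @ North # Diag # V @ East # Diag # W) - G (U @ North # Diag # V @ East # Diag # W)"
      using F G unfolding bounce_condition_iff by metis
  qed (rule q_indet_neq_1)
  \<comment> \<open>Values agree on hooks by (i), and agreement on two words passes to their
    concatenation by (ii).\<close>
  have "F P - G P \<in> {0}" if "P \<in> SCH" for P
  proof (rule F_in_subspace[OF _ _ _ _ that])
    show "subspace {0}" by (rule subspace_single_0)
  qed (use F G in \<open>auto simp: multiplicative_def\<close>)
  then show "F = G"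
    using F G by (intro PiE_ext[of F SCH "\<lambda>_. UNIV" G]) auto
qed

end
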